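(* Suppose the sampling and moment assumptions stated in the context hold, and that $H_0:\ E[Y_{12}\mid X_{12}]=X_{12}'\beta_*$ a.s. is false. Let $\nu$ be a fixed finite Borel measure on $\mathcal X$. Then $\sup_{x\in\mathcal X}|\Delta(x)|>0$ and $$\sup_{x\in\mathcal X}|\widehat R_n(x)|\to_p\sup_{x\in\mathcal X}|\Delta(x)|.$$ If $\int\Delta(x)^2\,d\nu(x)>0$, then $$\int\widehat R_n(x)^2\,d\nu(x)\to_p\int\Delta(x)^2\,d\nu(x).$$
   Context: Sampling assumption: node variables $(U_i)_{i\ge1}$ are i.i.d., dyad variables $(U_{ij})_{i<j}$ are i.i.d., and all are mutually independent. For $i<j$, $Z_{ij}=(Y_{ij},X_{ij}')'=\tau(U_i,U_j,U_{ij})$ with $\tau$ measurable and symmetric in its first two arguments, $Y_{ij}\in\mathbb R$, $X_{ij}\in\mathcal X\subset\mathbb R^d$, $\mathcal X$ a compact rectangle. One observes $Z_{ij}$ for $1\le i<j\le n$. $N_n=n(n-1)/2$, $\mathbb P_nf=N_n^{-1}\sum_{i<j}f(Z_{ij})$. Moment assumption: $\|X_{12}\|\le C_X<\infty$ a.s.; $E|Y_{12}|^{4+\delta}<\infty$ for some $\delta>0$; $Q=E[X_{12}X_{12}']$ has smallest eigenvalue bounded away from zero. Objects ($\preceq$ is coordinatewise inequality): $\beta_*=Q^{-1}E[X_{12}Y_{12}]$, $\varepsilon_{ij}=Y_{ij}-X_{ij}'\beta_*$, $\Delta(x)=E[\varepsilon_{12}\mathbf 1\{X_{12}\preceq x\}]$;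 $Q_n=\mathbb P_n(XX')$, $\widehat\beta=Q_n^{-1}\mathbb P_n(XY)$ (arbitrary if $Q_n$ is singular), $\widehat\varepsilon_{ij}=Y_{ij}-X_{ij}'\widehat\beta$, $\widehat R_n(x)=\mathbb P_n[\widehat\varepsilon\,\mathbf 1\{X\preceq x\}]$, $x\in\mathcal X$. *)

theory Defs
  imports "HOL-Probability.Probability"
begin

definition node_indices :: "nat set" where
  "node_indices = {1..}"

definition dyad_indices :: "(nat \<times> nat) set" where
  "dyad_indices = {(i, j). 1 \<le> i \<and> i < j}"

definition dyads :: "nat \<Rightarrow> (nat \<times> nat) set" where
  "dyads n = {(i, j). 1 \<le> i \<and> i < j \<and> j \<le> n}"

(* The node variables and the dyad variables may take values in different types, whereas
   prob_space.indep_vars needs a single one.  The mutual independence of the joint family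
   is therefore stated as indep_vars unfolds: independence of the families of preimages,
   here over the disjoint union of the two index sets. *)
locale dyadic_sampling = prob_space M
  for M :: "'w measure"
    and S :: "'u measure" and T :: "'v measure"
    and U :: "nat \<Rightarrow> 'w \<Rightarrow> 'u" and V :: "nat \<Rightarrow> nat \<Rightarrow> 'w \<Rightarrow> 'v"
    and \<tau> :: "'u \<Rightarrow> 'u \<Rightarrow> 'v \<Rightarrow> real \<times> (real ^ 'd)"
    and Y :: "nat \<Rightarrow> nat \<Rightarrow> 'w \<Rightarrow> real" and X :: "nat \<Rightarrow> nat \<Rightarrow> 'w \<Rightarrow> real ^ 'd"
    and \<X> :: "(real ^ 'd) set" +
  assumes node_measurable: "i \<in> node_indices \<Longrightarrow> U i \<in> measurable M S"
    and dyad_measurable: "(i, j) \<in> dyad_indices \<Longrightarrow> V i j \<in> measurable M T"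
    and mutually_indep:
      "indep_sets
         (case_sum (\<lambda>i. {U i -` A \<inter> space M | A. A \<in> sets S})
                   (\<lambda>(i, j). {V i j -` A \<inter> space M | A. A \<in> sets T}))
         (node_indices <+> dyad_indices)"
    and node_ident: "i \<in> node_indices \<Longrightarrow> distr M S (U i) = distr M S (U 1)"
    and dyad_ident: "(i, j) \<in> dyad_indices \<Longrightarrow> distr M T (V i j) = distr M T (V 1 2)"
    and tau_measurable:
      "(\<lambda>(u, u', v). \<tau> u u' v) \<in> measurable (S \<Otimes>\<^sub>M S \<Otimes>\<^sub>M T) borel"
    and tau_symmetric:
      "u \<in> space S \<Longrightarrow> u' \<in> space S \<Longrightarrow> v \<in> space T \<Longrightarrow> \<tau> u u' v = \<tau> u' u v"
    and observation:
      "(i, j) \<in> dyad_indices \<Longrightarrow> \<omega> \<in> space M \<Longrightarrow>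
         (Y i j \<omega>, X i j \<omega>) = \<tau> (U i \<omega>) (U j \<omega>) (V i j \<omega>)"
    and covariate_range: "(i, j) \<in> dyad_indices \<Longrightarrow> \<omega> \<in> space M \<Longrightarrow> X i j \<omega> \<in> \<X>"

definition outer :: "real ^ 'd \<Rightarrow> real ^ 'd \<Rightarrow> real ^ 'd ^ 'd" where
  "outer x y = (\<chi> i j. x $ i * y $ j)"

(* For symmetric A the set below is finite and nonempty, so Min is well behaved. *)
definition smallest_eigenvalue :: "real ^ 'd ^ 'd \<Rightarrow> real" where
  "smallest_eigenvalue A = Min {l. \<exists>v. v \<noteq> 0 \<and> A *v v = l *\<^sub>R v}"

text \<open>Population quantities; the arguments \<open>Y\<close> and \<open>X\<close> are the random variables of one dyad.\<close>

definition pop_Q :: "'w measure \<Rightarrow> ('w \<Rightarrow> real ^ 'd) \<Rightarrow> real ^ 'd ^ 'd" where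
  "pop_Q M X = (\<integral>\<omega>. outer (X \<omega>) (X \<omega>) \<partial>M)"

definition beta_star :: "'w measure \<Rightarrow> ('w \<Rightarrow> real) \<Rightarrow> ('w \<Rightarrow> real ^ 'd) \<Rightarrow> real ^ 'd" where
  "beta_star M Y X = matrix_inv (pop_Q M X) *v (\<integral>\<omega>. Y \<omega> *\<^sub>R X \<omega> \<partial>M)"

(* The order on real ^ 'd is coordinatewise, so {..x} is the lower orthant at x. *)
definition Delta :: "'w measure \<Rightarrow> ('w \<Rightarrow> real) \<Rightarrow> ('w \<Rightarrow> real ^ 'd) \<Rightarrow> real ^ 'd \<Rightarrow> real" where
  "Delta M Y X x =
     (\<integral>\<omega>. (Y \<omega> - X \<omega> \<bullet> beta_star M Y X) * indicator {..x} (X \<omega>) \<partial>M)"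

definition linear_cond_mean :: "'w measure \<Rightarrow> ('w \<Rightarrow> real) \<Rightarrow> ('w \<Rightarrow> real ^ 'd) \<Rightarrow> bool" where
  "linear_cond_mean M Y X \<longleftrightarrow>
     (AE \<omega> in M. real_cond_exp M (vimage_algebra (space M) X borel) Y \<omega>
                  = X \<omega> \<bullet> beta_star M Y X)"

text \<open>Sample quantities; the arguments \<open>y\<close> and \<open>x\<close> are realised arrays.\<close>

definition dyad_mean :: "nat \<Rightarrow> (nat \<Rightarrow> nat \<Rightarrow> 'b::real_vector) \<Rightarrow> 'b" where
  "dyad_mean n f = (1 / (real n * (real n - 1) / 2)) *\<^sub>R (\<Sum>(i, j)\<in>dyads n. f i j)"

definition sample_Q :: "nat \<Rightarrow> (nat \<Rightarrow> nat \<Rightarrow> real ^ 'd) \<Rightarrow> real ^ 'd ^ 'd" where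
  "sample_Q n x = dyad_mean n (\<lambda>i j. outer (x i j) (x i j))"

(* No constraint when the Gram matrix is singular: the estimator is then arbitrary. *)
definition is_ols ::
  "nat \<Rightarrow> (nat \<Rightarrow> nat \<Rightarrow> real) \<Rightarrow> (nat \<Rightarrow> nat \<Rightarrow> real ^ 'd) \<Rightarrow> real ^ 'd \<Rightarrow> bool" where
  "is_ols n y x b \<longleftrightarrow>
     (invertible (sample_Q n x) \<longrightarrow>
        b = matrix_inv (sample_Q n x) *v dyad_mean n (\<lambda>i j. y i j *\<^sub>R x i j))"

definition R_hat ::
  "nat \<Rightarrow> (nat \<Rightarrow> nat \<Rightarrow> real) \<Rightarrow> (nat \<Rightarrow> nat \<Rightarrow> real ^ 'd) \<Rightarrow> real ^ 'd \<Rightarrow> real ^ 'd \<Rightarrow> real"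
  where
  "R_hat n y x b t = dyad_mean n (\<lambda>i j. (y i j - x i j \<bullet> b) * indicator {..t} (x i j))"

(* Measurability is part of the definition: otherwise the probabilities below would be
   the default value 0 for non-measurable events. *)
definition tendsto_in_prob :: "'w measure \<Rightarrow> (nat \<Rightarrow> 'w \<Rightarrow> real) \<Rightarrow> real \<Rightarrow> bool" where
  "tendsto_in_prob M W c \<longleftrightarrow>
     (\<forall>n. W n \<in> borel_measurable M) \<and>
     (\<forall>e>0. (\<lambda>n. measure M {\<omega> \<in> space M. \<bar>W n \<omega> - c\<bar> > e}) \<longlonglongrightarrow> 0)"

end

theory Submission
  imports Defs
begin

text \<open>
  Observations of disjoint dyads are independent, and a dyad meets only \<open>O(n)\<close> of the \<open>O(n\<^sup>2)\<close>
  others, so the variance of a dyadic mean is \<open>O(1/n)\<close>: Chebyshev's inequality gives a weak law.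
  The lower orthants with apex in a compact rectangle admit finite brackets with respect to any
  finite measure, which makes the weak law for the residuals uniform over orthants.  Least squares
  is consistent because the solution of a nonsingular linear system is stable under small
  perturbations, and replacing the estimated by the true coefficients changes the residual process
  by at most a constant times the estimation error, uniformly.  Hence \<open>R_hat\<close> tends to \<open>Delta\<close>
  uniformly in probability, and both functionals follow.
\<close>

subsection \<open>A weak law for dyadic means\<close>

text \<open>Residuals are unbounded and the covariates may have atoms. Brackets are therefore
  measured by the law of the covariate weighted with the absolute residual: a finite measure,
  because the residual is integrable, in which a small gap between the sides of a bracket means a
  small contribution to the mean. Uniform statements range over uncountably many orthants, so their
  events need not be measurable; they are controlled through measurable exceptional events.
  Measurability of the two statistics, which convergence in probability demands, is shown
  separately: by a countable set of apices for the supremum, by joint measurability for the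
  integral. Singular Gram matrices need no case of their own: entrywise closeness to a nonsingular
  matrix forces invertibility, so the arbitrary values of the estimator are confined to exceptional
  events. Positivity of the limiting supremum involves no asymptotics: it is the contrapositive of
  the fact that integrals of the residual over orthants determine its conditional mean given the
  covariate.\<close>

text \<open>A sigma-finite product measure is determined by measurable rectangles. The product rule
  is phrased with preimages because the two variables may have different value types, as node and
  dyad variables do.\<close>

lemma (in prob_space) distr_pair_eq_pair_measure:
  assumes X: "X \<in> measurable M N" and Y: "Y \<in> measurable M L"
    and indep: "\<And>A B. A \<in> sets N \<Longrightarrow> B \<in> sets L \<Longrightarrow>
      prob ((X -` A \<inter> space M) \<inter> (Y -` B \<inter> space M)) =
      prob (X -` A \<inter> space M) * prob (Y -` B \<inter> space M)"
  shows "distr M (N \<Otimes>\<^sub>M L) (\<lambda>\<omega>. (X \<omega>, Y \<omega>)) = distr M N X \<Otimes>\<^sub>M distr M L Y"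
proof (rule sym, rule pair_measure_eqI)
  note [measurable] = X Y
  interpret DX: prob_space "distr M N X" by (rule prob_space_distr) fact
  interpret DY: prob_space "distr M L Y" by (rule prob_space_distr) fact
  show "sigma_finite_measure (distr M N X)" "sigma_finite_measure (distr M L Y)" by unfold_locales
  show "sets (distr M N X \<Otimes>\<^sub>M distr M L Y) =
        sets (distr M (N \<Otimes>\<^sub>M L) (\<lambda>\<omega>. (X \<omega>, Y \<omega>)))" by simp
  fix A B assume "A \<in> sets (distr M N X)" "B \<in> sets (distr M L Y)"
  then have AB[measurable]: "A \<in> sets N" "B \<in> sets L" by auto
  have "(\<lambda>\<omega>. (X \<omega>, Y \<omega>)) -` (A \<times> B) \<inter> space M = (X -` A \<inter> space M) \<inter> (Y -` B \<inter> space M)" by auto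
  then show "emeasure (distr M N X) A * emeasure (distr M L Y) B =
        emeasure (distr M (N \<Otimes>\<^sub>M L) (\<lambda>\<omega>. (X \<omega>, Y \<omega>))) (A \<times> B)"
    using indep[OF AB]
    by (simp add: emeasure_distr emeasure_eq_measure ennreal_mult[symmetric])
qed

lemma finite_dyads: "finite (dyads n)"
  by (rule finite_subset[of _ "{1..n} \<times> {1..n}"]) (auto simp: dyads_def)

lemma dyads_subset_dyad_indices: "dyads n \<subseteq> dyad_indices"
  by (auto simp: dyads_def dyad_indices_def)

text \<open>Makes \<open>dyad_mean\<close> an ordinary average. The real-valued formula also gives 0
  at \<open>n = 0\<close> and \<open>n = 1\<close>, where there are no dyads.\<close>

lemma card_dyads: "real (card (dyads n)) = real n * (real n - 1) / 2"
proof (induction n)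
  case (Suc n)
  have "dyads (Suc n) = dyads n \<union> (\<lambda>i. (i, Suc n)) ` {1..n}"
    by (auto simp: dyads_def image_def)
  moreover have "dyads n \<inter> (\<lambda>i. (i, Suc n)) ` {1..n} = {}" by (auto simp: dyads_def)
  ultimately have "card (dyads (Suc n)) = card (dyads n) + n"
    using finite_dyads[of n] by (simp add: card_Un_disjoint card_image inj_on_def)
  then show ?case using Suc by (simp add: field_simps)
next
  case 0
  have "dyads 0 = {}" by (auto simp: dyads_def)
  then show ?case by simp
qed

text \<open>The dependence graph of the array. Every pair overlaps itself, so the diagonal terms of
  the variance are counted along with the others.\<close>

definition overlap :: "nat \<times> nat \<Rightarrow> nat \<times> nat \<Rightarrow> bool" where
  "overlap p q \<longleftrightarrow> {fst p, snd p} \<inter> {fst q, snd q} \<noteq> {}"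

text \<open>One endpoint of \<open>q\<close> is among the at most two endpoints of \<open>p\<close>,
  the other is in \<open>{1..n}\<close>, and either may come first:
  \<open>2 * (2 * n)\<close>.\<close>

lemma card_overlap_le: "card {q \<in> dyads n. overlap p q} \<le> 4 * n"
proof -
  let ?S = "{fst p, snd p}"
  have c: "card ?S \<le> 2" by (simp add: card_insert_if)
  have "card {q \<in> dyads n. overlap p q} \<le> card (?S \<times> {1..n} \<union> {1..n} \<times> ?S)"
    by (rule card_mono) (auto simp: dyads_def overlap_def)
  also have "\<dots> \<le> card (?S \<times> {1..n}) + card ({1..n} \<times> ?S)" by (rule card_Un_le)
  also have "\<dots> = 2 * (card ?S * n)" by (simp only: card_cartesian_product) simp
  also have "\<dots> \<le> 2 * (2 * n)" using c by (intro mult_le_mono) auto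
  finally show ?thesis by simp
qed

section \<open>Latent sigma-algebras and the joint law of the observations\<close>

context dyadic_sampling
begin

definition latent_events :: "nat + nat \<times> nat \<Rightarrow> 'w set set" where
  "latent_events = case_sum (\<lambda>i. {U i -` A \<inter> space M | A. A \<in> sets S})
                  (\<lambda>(i, j). {V i j -` A \<inter> space M | A. A \<in> sets T})"

text \<open>Information carried by the latent variables with index in \<open>K\<close>. Only the
  sigma-algebra matters; packaging it as a measure lets \<open>measurable\<close> express dependence
  on these variables alone.\<close>

definition latent_sigma :: "(nat + nat \<times> nat) set \<Rightarrow> 'w measure" where
  "latent_sigma K = sigma (space M) (\<Union>k\<in>K. latent_events k)"

lemma latent_events_subset: "latent_events k \<subseteq> Pow (space M)"
  by (auto simp: latent_events_def split: sum.splits)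

lemma sets_latent_sigma: "sets (latent_sigma K) = sigma_sets (space M) (\<Union>k\<in>K. latent_events k)"
  and space_latent_sigma [simp]: "space (latent_sigma K) = space M"
  unfolding latent_sigma_def using latent_events_subset by (auto intro!: sets_measure_of space_measure_of)

lemma Int_stable_latent_events: "Int_stable (latent_events k)"
proof -
  have *: "Int_stable {f -` A \<inter> \<Omega> | A. A \<in> sets N}" for f :: "'w \<Rightarrow> 'x" and \<Omega> and N :: "'x measure"
    unfolding Int_stable_def
  proof (safe, goal_cases)
    case (1 _ _ A B)
    then show ?case by (intro exI[of _ "A \<inter> B"]) auto
  qed
  show ?thesis unfolding latent_events_def by (auto split: sum.splits intro!: *)
qed

text \<open>The preimage families are pi-systems, so their independence passes to the sigma-algebras
  generated by disjoint blocks of indices. All independence used later comes from here.\<close>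

lemma prob_Int_latent_sigma:
  assumes K: "K \<subseteq> node_indices <+> dyad_indices" and L: "L \<subseteq> node_indices <+> dyad_indices"
    and disj: "K \<inter> L = {}" and A: "A \<in> sets (latent_sigma K)" and B: "B \<in> sets (latent_sigma L)"
  shows "prob (A \<inter> B) = prob A * prob B"
proof -
  let ?I = "case_bool K L"
  have "indep_sets latent_events (\<Union>b\<in>UNIV. ?I b)"
    using mutually_indep K L unfolding latent_events_def[symmetric]
    by (rule_tac indep_sets_mono_index) (auto simp: UNIV_bool)
  then have "indep_sets (\<lambda>b. sigma_sets (space M) (\<Union>i\<in>?I b. latent_events i)) UNIV"
    by (rule indep_sets_collect_sigma)
       (use disj in \<open>auto simp: Int_stable_latent_events disjoint_family_on_def split: bool.split\<close>)
  moreover have "(\<lambda>b. sigma_sets (space M) (\<Union>i\<in>?I b. latent_events i)) =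
      case_bool (sets (latent_sigma K)) (sets (latent_sigma L))"
    by (auto simp: fun_eq_iff sets_latent_sigma split: bool.split)
  ultimately have "indep_set (sets (latent_sigma K)) (sets (latent_sigma L))" by (simp add: indep_set_def)
  then show ?thesis using A B by (simp add: indep_sets2_eq)
qed

lemma measurable_latent_sigma_node: "Inl i \<in> K \<Longrightarrow> i \<in> node_indices \<Longrightarrow> U i \<in> measurable (latent_sigma K) S"
  using measurable_space[OF node_measurable]
  by (intro measurableI)
     (auto simp: sets_latent_sigma latent_events_def intro!: sigma_sets.Basic bexI[of _ "Inl i"] exI[of _ "_ :: 'u set"])

lemma measurable_latent_sigma_dyad: "Inr (i, j) \<in> K \<Longrightarrow> (i, j) \<in> dyad_indices \<Longrightarrow> V i j \<in> measurable (latent_sigma K) T"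
  using measurable_space[OF dyad_measurable]
  by (intro measurableI)
     (auto simp: sets_latent_sigma latent_events_def intro!: sigma_sets.Basic bexI[of _ "Inr (i, j)"] exI[of _ "_ :: 'v set"])

lemma dyad_in_node: "(i, j) \<in> dyad_indices \<Longrightarrow> i \<in> node_indices \<and> j \<in> node_indices \<and> i \<noteq> j"
  by (auto simp: dyad_indices_def node_indices_def)

text \<open>The rectangle criterion is applied twice, to \<open>U j\<close> against
  \<open>V i j\<close> and then to \<open>U i\<close> against that pair; the right-hand side no
  longer mentions the dyad, which is what identical distribution of the observations needs.\<close>

lemma distr_latent:
  assumes ij: "(i, j) \<in> dyad_indices"
  shows "distr M (S \<Otimes>\<^sub>M S \<Otimes>\<^sub>M T) (\<lambda>\<omega>. (U i \<omega>, U j \<omega>, V i j \<omega>)) =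
    distr M S (U 1) \<Otimes>\<^sub>M distr M S (U 1) \<Otimes>\<^sub>M distr M T (V 1 2)"
proof -
  note n = dyad_in_node[OF ij]
  have [measurable]: "U i \<in> measurable M S" "U j \<in> measurable M S" "V i j \<in> measurable M T"
    using n ij by (auto intro: node_measurable dyad_measurable)
  let ?K = "{Inl i}" and ?L = "{Inl j, Inr (i, j)}"
  have [measurable]: "U i \<in> measurable (latent_sigma ?K) S" "U j \<in> measurable (latent_sigma {Inl j}) S"
      "V i j \<in> measurable (latent_sigma {Inr (i, j)}) T"
      "U j \<in> measurable (latent_sigma ?L) S" "V i j \<in> measurable (latent_sigma ?L) T"
    using n ij by (auto intro: measurable_latent_sigma_node measurable_latent_sigma_dyad)
  have p: "(\<lambda>\<omega>. (U j \<omega>, V i j \<omega>)) \<in> measurable (latent_sigma ?L) (S \<Otimes>\<^sub>M T)" by measurable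
  have "distr M (S \<Otimes>\<^sub>M T) (\<lambda>\<omega>. (U j \<omega>, V i j \<omega>)) = distr M S (U j) \<Otimes>\<^sub>M distr M T (V i j)"
  proof (rule distr_pair_eq_pair_measure)
    fix A B assume "A \<in> sets S" "B \<in> sets T"
    then have "U j -` A \<inter> space M \<in> sets (latent_sigma {Inl j})" "V i j -` B \<inter> space M \<in> sets (latent_sigma {Inr (i, j)})"
      using measurable_sets[of "U j" "latent_sigma {Inl j}" S A] measurable_sets[of "V i j" "latent_sigma {Inr (i, j)}" T B]
      by auto
    then show "prob ((U j -` A \<inter> space M) \<inter> (V i j -` B \<inter> space M)) =
      prob (U j -` A \<inter> space M) * prob (V i j -` B \<inter> space M)"
      using n ij by (rule_tac prob_Int_latent_sigma[of "{Inl j}" "{Inr (i, j)}"]) auto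
  qed measurable
  moreover have "distr M (S \<Otimes>\<^sub>M S \<Otimes>\<^sub>M T) (\<lambda>\<omega>. (U i \<omega>, U j \<omega>, V i j \<omega>)) =
     distr M S (U i) \<Otimes>\<^sub>M distr M (S \<Otimes>\<^sub>M T) (\<lambda>\<omega>. (U j \<omega>, V i j \<omega>))"
  proof (rule distr_pair_eq_pair_measure)
    fix A B assume "A \<in> sets S" "B \<in> sets (S \<Otimes>\<^sub>M T)"
    then have "U i -` A \<inter> space M \<in> sets (latent_sigma ?K)"
        "(\<lambda>\<omega>. (U j \<omega>, V i j \<omega>)) -` B \<inter> space M \<in> sets (latent_sigma ?L)"
      using measurable_sets[of "U i" "latent_sigma ?K" S A] measurable_sets[OF p, of B] by auto
    then show "prob ((U i -` A \<inter> space M) \<inter> ((\<lambda>\<omega>. (U j \<omega>, V i j \<omega>)) -` B \<inter> space M)) =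
      prob (U i -` A \<inter> space M) * prob ((\<lambda>\<omega>. (U j \<omega>, V i j \<omega>)) -` B \<inter> space M)"
      using n ij by (rule_tac prob_Int_latent_sigma[of ?K ?L]) auto
  qed measurable
  moreover have "distr M S (U i) = distr M S (U 1)" "distr M S (U j) = distr M S (U 1)"
      "distr M T (V i j) = distr M T (V 1 2)"
    using n node_ident[of i] node_ident[of j] dyad_ident[OF ij] by blast+
  ultimately show ?thesis by simp
qed

definition Z :: "nat \<times> nat \<Rightarrow> 'w \<Rightarrow> real \<times> (real ^ 'd)" where
  "Z p \<omega> = (Y (fst p) (snd p) \<omega>, X (fst p) (snd p) \<omega>)"

lemma one_two_dyad [simp]: "(1, 2) \<in> dyad_indices" "(Suc 0, 2) \<in> dyad_indices"
  by (auto simp: dyad_indices_def)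

lemma Z_eq:
  "p \<in> dyad_indices \<Longrightarrow> \<omega> \<in> space M \<Longrightarrow>
    Z p \<omega> = (\<lambda>(u, u', v). \<tau> u u' v) (U (fst p) \<omega>, U (snd p) \<omega>, V (fst p) (snd p) \<omega>)"
  by (cases p) (simp add: Z_def observation)

text \<open>An observation reads only its two nodes and its own dyad variable. For dyads without a
  common node these index blocks are disjoint, which yields independence.\<close>

lemma measurable_Z_latent_sigma:
  assumes p: "p \<in> dyad_indices"
  shows "Z p \<in> borel_measurable (latent_sigma {Inl (fst p), Inl (snd p), Inr p})"
proof -
  obtain i j where ij: "p = (i, j)" by (cases p)
  let ?K = "{Inl i, Inl j, Inr (i, j)}"
  note n = dyad_in_node[OF p[unfolded ij]]
  have [measurable]: "U i \<in> measurable (latent_sigma ?K) S" "U j \<in> measurable (latent_sigma ?K) S"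
      "V i j \<in> measurable (latent_sigma ?K) T"
    using n p ij by (auto intro: measurable_latent_sigma_node measurable_latent_sigma_dyad)
  note [measurable] = tau_measurable
  have "(\<lambda>\<omega>. (\<lambda>(u, u', v). \<tau> u u' v) (U i \<omega>, U j \<omega>, V i j \<omega>)) \<in> borel_measurable (latent_sigma ?K)"
    by measurable
  then show ?thesis
    using p by (subst measurable_cong[OF Z_eq]) (auto simp: ij)
qed

lemma measurable_Z [measurable]:
  assumes p: "p \<in> dyad_indices" shows "Z p \<in> borel_measurable M"
proof (rule measurableI)
  fix A :: "(real \<times> (real ^ 'd)) set" assume "A \<in> sets borel"
  then have "Z p -` A \<inter> space M \<in> sets (latent_sigma {Inl (fst p), Inl (snd p), Inr p})"
    using measurable_sets[OF measurable_Z_latent_sigma[OF p]] by auto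
  moreover have "latent_events k \<subseteq> events" if "k \<in> node_indices <+> dyad_indices" for k
    using that node_measurable dyad_measurable unfolding latent_events_def by (auto intro: measurable_sets)
  then have "sets (latent_sigma {Inl (fst p), Inl (snd p), Inr p}) \<subseteq> events"
    using p dyad_in_node[of "fst p" "snd p"] unfolding sets_latent_sigma
    by (intro sets.sigma_sets_subset) auto
  ultimately show "Z p -` A \<inter> space M \<in> events" by auto
qed simp

lemma distr_Z:
  assumes p: "p \<in> dyad_indices"
  shows "distr M borel (Z p) = distr M borel (Z (1, 2))"
proof -
  let ?t = "\<lambda>(u, u', v). \<tau> u u' v"
  note [measurable] = tau_measurable
  have "distr M borel (Z p) = distr (distr M S (U 1) \<Otimes>\<^sub>M distr M S (U 1) \<Otimes>\<^sub>M distr M T (V 1 2)) borel ?t"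
    if p: "p \<in> dyad_indices" for p
  proof -
    have [measurable]: "U (fst p) \<in> measurable M S" "U (snd p) \<in> measurable M S"
        "V (fst p) (snd p) \<in> measurable M T"
      using dyad_in_node[of "fst p" "snd p"] p by (auto intro: node_measurable dyad_measurable)
    have "distr M borel (Z p) =
        distr M borel (?t \<circ> (\<lambda>\<omega>. (U (fst p) \<omega>, U (snd p) \<omega>, V (fst p) (snd p) \<omega>)))"
      by (rule distr_cong) (auto simp: Z_eq[OF p])
    also have "\<dots> = distr (distr M (S \<Otimes>\<^sub>M S \<Otimes>\<^sub>M T)
        (\<lambda>\<omega>. (U (fst p) \<omega>, U (snd p) \<omega>, V (fst p) (snd p) \<omega>))) borel ?t"
      by (subst distr_distr) measurable
    finally show ?thesis using p by (simp add: distr_latent)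
  qed
  from this[OF p] this[of "(1, 2)"] show ?thesis by simp
qed

lemma indep_var_Z:
  assumes p: "p \<in> dyad_indices" and q: "q \<in> dyad_indices" and "\<not> overlap p q"
    and [measurable]: "h \<in> borel_measurable borel"
  shows "indep_var borel (\<lambda>\<omega>. h (Z p \<omega>) :: real) borel (\<lambda>\<omega>. h (Z q \<omega>))"
proof -
  let ?G = "\<lambda>p. latent_sigma {Inl (fst p), Inl (snd p), Inr p}"
  have sub: "sigma_sets (space M) {(\<lambda>\<omega>. h (Z p \<omega>)) -` A \<inter> space M |A. A \<in> sets borel} \<subseteq> sets (?G p)"
    if "p \<in> dyad_indices" for p
  proof -
    have "(\<lambda>\<omega>. h (Z p \<omega>)) \<in> borel_measurable (?G p)"
      using measurable_compose[OF measurable_Z_latent_sigma[OF that] assms(4)] .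
    then have "{(\<lambda>\<omega>. h (Z p \<omega>)) -` A \<inter> space M |A. A \<in> sets borel} \<subseteq> sets (?G p)"
      by (auto dest: measurable_sets)
    then show ?thesis using sets.sigma_sets_subset[of _ "?G p"] by simp
  qed
  have sub2: "sigma_sets (space M) {(\<lambda>\<omega>. h (Z p \<omega>)) -` A \<inter> space M |A. A \<in> sets borel} \<subseteq> events"
    if [measurable]: "p \<in> dyad_indices" for p
    by (intro sets.sigma_sets_subset) auto
  have "prob (A \<inter> B) = prob A * prob B" if "A \<in> sets (?G p)" "B \<in> sets (?G q)" for A B
    using that p q dyad_in_node[of "fst p" "snd p"] dyad_in_node[of "fst q" "snd q"] assms(3)
    by (intro prob_Int_latent_sigma) (auto simp: overlap_def)
  with sub[OF p] sub[OF q] sub2[OF p] sub2[OF q] p q show ?thesis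
    unfolding indep_var_eq indep_sets2_eq by (auto 0 3)
qed

lemma integral_Z:
  assumes "p \<in> dyad_indices" and [measurable]: "h \<in> borel_measurable borel"
  shows "expectation (\<lambda>\<omega>. h (Z p \<omega>) :: real) = expectation (\<lambda>\<omega>. h (Z (1, 2) \<omega>))"
    and "integrable M (\<lambda>\<omega>. h (Z p \<omega>) :: real) \<longleftrightarrow> integrable M (\<lambda>\<omega>. h (Z (1, 2) \<omega>))"
  using integral_distr[of "Z p" M borel h] integral_distr[of "Z (1, 2)" M borel h]
    integrable_distr_eq[of "Z p" M borel h] integrable_distr_eq[of "Z (1, 2)" M borel h]
    distr_Z[OF assms(1)] measurable_Z[OF assms(1)]
  by auto

text \<open>In the expanded square, pairs without a common node contribute a product of zero means.
  Each remaining pair contributes at most one second moment, and every dyad has at most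
  \<open>4 * n\<close> such partners.\<close>

lemma second_moment_dyad_sum_le:
  fixes h :: "real \<times> (real ^ 'd) \<Rightarrow> real"
  assumes [measurable]: "h \<in> borel_measurable borel"
    and sq: "integrable M (\<lambda>\<omega>. (h (Z (1, 2) \<omega>))\<^sup>2)"
    and mean0: "expectation (\<lambda>\<omega>. h (Z (1, 2) \<omega>)) = 0"
  shows "integrable M (\<lambda>\<omega>. (\<Sum>p\<in>dyads n. h (Z p \<omega>))\<^sup>2)" (is ?i)
    and "expectation (\<lambda>\<omega>. (\<Sum>p\<in>dyads n. h (Z p \<omega>))\<^sup>2) \<le>
      real (card (dyads n)) * (4 * real n) * expectation (\<lambda>\<omega>. (h (Z (1, 2) \<omega>))\<^sup>2)" (is ?e)
proof -
  let ?s = "expectation (\<lambda>\<omega>. (h (Z (1, 2) \<omega>))\<^sup>2)"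
  have sq': "integrable M (\<lambda>\<omega>. (h (Z p \<omega>))\<^sup>2)" "expectation (\<lambda>\<omega>. (h (Z p \<omega>))\<^sup>2) = ?s"
    if "p \<in> dyads n" for p
    using integral_Z[of p "\<lambda>z. (h z)\<^sup>2"] that sq dyads_subset_dyad_indices[of n] by auto
  have m: "(\<lambda>\<omega>. h (Z p \<omega>)) \<in> borel_measurable M" if "p \<in> dyads n" for p
    using that dyads_subset_dyad_indices[of n]
    by (intro measurable_compose[OF measurable_Z assms(1)]) auto
  \<comment> \<open>This bound serves twice: it makes the products integrable and bounds the terms
    of overlapping pairs.\<close>
  have le: "\<bar>x * y\<bar> \<le> (x\<^sup>2 + y\<^sup>2) / 2" for x y :: real
    using sum_squares_bound[of "\<bar>x\<bar>" "\<bar>y\<bar>"] by (simp add: abs_mult)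
  have ii: "integrable M (\<lambda>\<omega>. (h (Z p \<omega>))\<^sup>2 + (h (Z q \<omega>))\<^sup>2)"
    if "p \<in> dyads n" "q \<in> dyads n" for p q using sq' that by auto
  have pr: "integrable M (\<lambda>\<omega>. h (Z p \<omega>) * h (Z q \<omega>))" if "p \<in> dyads n" "q \<in> dyads n" for p q
    using m[OF that(1)] m[OF that(2)] le
    by (intro Bochner_Integration.integrable_bound[OF integrable_divide_zero[of 2, OF ii[OF that]]]) auto
  have prle: "expectation (\<lambda>\<omega>. h (Z p \<omega>) * h (Z q \<omega>)) \<le> (if overlap p q then ?s else 0)"
    if "p \<in> dyads n" "q \<in> dyads n" for p q
  proof (cases "overlap p q")
    case True
    have "expectation (\<lambda>\<omega>. h (Z p \<omega>) * h (Z q \<omega>)) \<le>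
        expectation (\<lambda>\<omega>. ((h (Z p \<omega>))\<^sup>2 + (h (Z q \<omega>))\<^sup>2) / 2)"
      using pr[OF that] ii[OF that] le
      by (intro integral_mono) (blast intro: order_trans[OF abs_ge_self] | simp)+
    also have "\<dots> = ?s" using sq' that by simp
    finally show ?thesis using True by simp
  next
    case False
    have i: "integrable M (\<lambda>\<omega>. h (Z p \<omega>))" if "p \<in> dyads n" for p
      using m[OF that] sq'(1)[OF that] by (rule square_integrable_imp_integrable)
    have "expectation (\<lambda>\<omega>. h (Z p \<omega>) * h (Z q \<omega>)) =
        expectation (\<lambda>\<omega>. h (Z p \<omega>)) * expectation (\<lambda>\<omega>. h (Z q \<omega>))"
      using that False dyads_subset_dyad_indices[of n]
      by (intro indep_var_lebesgue_integral indep_var_Z i) auto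
    also have "\<dots> = 0"
      using integral_Z(1)[of p h] mean0 that dyads_subset_dyad_indices[of n] by auto
    finally show ?thesis using False by simp
  qed
  have eq: "(\<Sum>p\<in>dyads n. h (Z p \<omega>))\<^sup>2 = (\<Sum>p\<in>dyads n. \<Sum>q\<in>dyads n. h (Z p \<omega>) * h (Z q \<omega>))" for \<omega>
    by (simp add: power2_eq_square sum_product)
  show ?i unfolding eq using pr by auto
  have "expectation (\<lambda>\<omega>. (\<Sum>p\<in>dyads n. h (Z p \<omega>))\<^sup>2) =
      (\<Sum>p\<in>dyads n. \<Sum>q\<in>dyads n. expectation (\<lambda>\<omega>. h (Z p \<omega>) * h (Z q \<omega>)))"
    unfolding eq using pr by (simp add: Bochner_Integration.integral_sum)
  also have "\<dots> \<le> (\<Sum>p\<in>dyads n. \<Sum>q\<in>dyads n. if overlap p q then ?s else 0)"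
    by (intro sum_mono prle)
  also have "\<dots> = (\<Sum>p\<in>dyads n. real (card {q \<in> dyads n. overlap p q}) * ?s)"
    using finite_dyads[of n] by (simp add: sum.If_cases Int_def)
  also have "\<dots> \<le> (\<Sum>p\<in>dyads n. (4 * real n) * ?s)"
    using card_overlap_le[of n]
    by (intro sum_mono mult_right_mono) (auto simp flip: of_nat_le_iff[where 'a=real])
  finally show ?e by simp
qed

text \<open>``With probability tending to one'', through exceptional events, so that \<open>P\<close> itself need
  not be measurable.\<close>

definition whp :: "(nat \<Rightarrow> 'w \<Rightarrow> bool) \<Rightarrow> bool" where
  "whp P \<longleftrightarrow> (\<exists>E. (\<forall>n. E n \<in> events) \<and> (\<lambda>n. prob (E n)) \<longlonglongrightarrow> 0 \<and>
     (\<forall>n. \<forall>\<omega>\<in>space M. \<omega> \<notin> E n \<longrightarrow> P n \<omega>))"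

lemma whp_mono:
  assumes "whp P" and "\<And>n \<omega>. \<omega> \<in> space M \<Longrightarrow> P n \<omega> \<Longrightarrow> Q n \<omega>"
  shows "whp Q"
  using assms unfolding whp_def by meson

lemma whp_conj:
  assumes "whp P" "whp Q"
  shows "whp (\<lambda>n \<omega>. P n \<omega> \<and> Q n \<omega>)"
proof -
  from assms obtain E F where
    E: "\<And>n. E n \<in> events" "(\<lambda>n. prob (E n)) \<longlonglongrightarrow> 0" "\<And>n \<omega>. \<omega> \<in> space M \<Longrightarrow> \<omega> \<notin> E n \<Longrightarrow> P n \<omega>"
    and F: "\<And>n. F n \<in> events" "(\<lambda>n. prob (F n)) \<longlonglongrightarrow> 0" "\<And>n \<omega>. \<omega> \<in> space M \<Longrightarrow> \<omega> \<notin> F n \<Longrightarrow> Q n \<omega>"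
    unfolding whp_def by metis
  have "(\<lambda>n. prob (E n \<union> F n)) \<longlonglongrightarrow> 0"
  proof (rule tendsto_sandwich[OF _ _ tendsto_const])
    show "(\<lambda>n. prob (E n) + prob (F n)) \<longlonglongrightarrow> 0" using tendsto_add[OF E(2) F(2)] by simp
    show "\<forall>\<^sub>F n in sequentially. prob (E n \<union> F n) \<le> prob (E n) + prob (F n)"
      using E(1) F(1) by (auto intro!: always_eventually measure_Un_le)
  qed auto
  then show ?thesis unfolding whp_def using E F by (intro exI[of _ "\<lambda>n. E n \<union> F n"]) auto
qed

text \<open>Exceptional probabilities add up, so only finitely many statements can be combined in
  this way; uniformity over orthants has to be reduced to this case.\<close>

lemma whp_ball_finite:
  assumes "finite I" and "\<And>i. i \<in> I \<Longrightarrow> whp (P i)"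
  shows "whp (\<lambda>n \<omega>. \<forall>i\<in>I. P i n \<omega>)"
  using assms
proof (induction I rule: finite_induct)
  case empty
  show ?case unfolding whp_def by (auto intro!: exI[of _ "\<lambda>_. {}"])
next
  case (insert i I)
  have "whp (\<lambda>n \<omega>. P i n \<omega> \<and> (\<forall>i\<in>I. P i n \<omega>))"
    using insert by (intro whp_conj) auto
  then show ?case by (rule whp_mono) auto
qed

text \<open>The event of a deviation beyond \<open>e\<close> lies inside the exceptional event,
  whose probability vanishes.\<close>

lemma tendsto_in_prob_if_whp:
  assumes W: "\<And>n. W n \<in> borel_measurable M"
    and le: "\<And>e. e > 0 \<Longrightarrow> whp (\<lambda>n \<omega>. \<bar>W n \<omega> - c\<bar> \<le> e)"
  shows "tendsto_in_prob M W c"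
  unfolding tendsto_in_prob_def
proof (intro conjI allI impI W)
  fix e :: real assume "e > 0"
  from le[OF this] obtain E where
    E: "\<And>n. E n \<in> events" "(\<lambda>n. prob (E n)) \<longlonglongrightarrow> 0"
      "\<And>n \<omega>. \<omega> \<in> space M \<Longrightarrow> \<omega> \<notin> E n \<Longrightarrow> \<bar>W n \<omega> - c\<bar> \<le> e"
    unfolding whp_def by metis
  show "(\<lambda>n. prob {\<omega> \<in> space M. e < \<bar>W n \<omega> - c\<bar>}) \<longlonglongrightarrow> 0"
  proof (rule tendsto_sandwich[OF _ _ tendsto_const E(2)])
    show "\<forall>\<^sub>F n in sequentially. prob {\<omega> \<in> space M. e < \<bar>W n \<omega> - c\<bar>} \<le> prob (E n)"
      using E(3) by (intro always_eventually allI finite_measure_mono E(1)) (auto simp: not_le[symmetric])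
  qed auto
qed

definition zmean :: "nat \<Rightarrow> (real \<times> (real ^ 'd) \<Rightarrow> real) \<Rightarrow> 'w \<Rightarrow> real" where
  "zmean n h \<omega> = dyad_mean n (\<lambda>i j. h (Y i j \<omega>, X i j \<omega>))"

lemma zmean_eq: "zmean n h \<omega> = (\<Sum>p\<in>dyads n. h (Z p \<omega>)) / real (card (dyads n))"
  by (simp add: zmean_def dyad_mean_def card_dyads Z_def case_prod_beta)

text \<open>Chebyshev's inequality for the centred function \<open>?g\<close>, with the variance
  bound of \<open>second_moment_dyad_sum_le\<close>.\<close>

lemma weak_law:
  fixes h :: "real \<times> (real ^ 'd) \<Rightarrow> real"
  assumes h[measurable]: "h \<in> borel_measurable borel"
    and sq: "integrable M (\<lambda>\<omega>. (h (Z (1, 2) \<omega>))\<^sup>2)"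
    and e: "e > 0"
  shows "whp (\<lambda>n \<omega>. \<bar>zmean n h \<omega> - expectation (\<lambda>\<omega>. h (Z (1, 2) \<omega>))\<bar> \<le> e)"
proof -
  let ?m = "expectation (\<lambda>\<omega>. h (Z (1, 2) \<omega>))"
  let ?g = "\<lambda>z. h z - ?m"
  have [measurable]: "(\<lambda>\<omega>. h (Z (1, 2) \<omega>)) \<in> borel_measurable M" by measurable
  have i: "integrable M (\<lambda>\<omega>. h (Z (1, 2) \<omega>))"
    by (rule square_integrable_imp_integrable[OF _ sq]) simp
  define s where "s = expectation (\<lambda>\<omega>. (?g (Z (1, 2) \<omega>))\<^sup>2)"
  have gi: "integrable M (\<lambda>\<omega>. (?g (Z (1, 2) \<omega>))\<^sup>2)"
    unfolding power2_diff using i sq by auto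
  have g0: "expectation (\<lambda>\<omega>. ?g (Z (1, 2) \<omega>)) = 0" using i by (simp add: prob_space)
  have gm: "?g \<in> borel_measurable borel" by measurable
  note sm = second_moment_dyad_sum_le[OF gm gi g0]
  have Zm[measurable]: "Z p \<in> borel_measurable M" if "p \<in> dyads n" for p n
    using that dyads_subset_dyad_indices[of n] by auto
  define E where "E n = {\<omega>\<in>space M. e\<^sup>2 \<le> (zmean n ?g \<omega>)\<^sup>2}" for n
  have sz: "(zmean n ?g \<omega>)\<^sup>2 = (\<Sum>p\<in>dyads n. ?g (Z p \<omega>))\<^sup>2 / (real (card (dyads n)))\<^sup>2" for n \<omega>
    by (simp add: zmean_eq power_divide)
  have zi: "integrable M (\<lambda>\<omega>. (zmean n ?g \<omega>)\<^sup>2)" for n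
    unfolding sz using sm(1) by auto
  have Eev: "E n \<in> events" for n
    using borel_measurable_integrable[OF zi[of n]] unfolding E_def by measurable
  \<comment> \<open>The constant is \<open>4 * n\<close> divided by the number
    \<open>n * (n - 1) / 2\<close> of dyads, that is \<open>8 / (n - 1)\<close>.\<close>
  have bound: "prob (E n) \<le> 8 * s / e\<^sup>2 / (real n - 1)" if "n \<ge> 2" for n
  proof -
    have N: "real (card (dyads n)) > 0" using that by (simp add: card_dyads)
    have "prob (E n) \<le> expectation (\<lambda>\<omega>. (zmean n ?g \<omega>)\<^sup>2) / e\<^sup>2"
      unfolding E_def using e by (intro integral_Markov_inequality_measure[OF zi, of "{}"]) auto
    also have "expectation (\<lambda>\<omega>. (zmean n ?g \<omega>)\<^sup>2) \<le>
        real (card (dyads n)) * (4 * real n) * s / (real (card (dyads n)))\<^sup>2"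
      unfolding sz using sm(2)[of n] by (simp add: s_def divide_right_mono)
    also have "\<dots> = 8 * s / (real n - 1)"
    proof -
      have "real (card (dyads n)) * (4 * real n) * s / (real (card (dyads n)))\<^sup>2 =
          4 * real n * s / real (card (dyads n))"
        using N by (simp add: power2_eq_square)
      also have "\<dots> = 8 * s / (real n - 1)"
        using that unfolding card_dyads by (simp add: divide_simps)
      finally show ?thesis .
    qed
    finally show ?thesis using e by (simp add: divide_right_mono field_simps)
  qed
  have "(\<lambda>n. prob (E n)) \<longlonglongrightarrow> 0"
  proof (rule tendsto_sandwich[OF _ _ tendsto_const])
    show "\<forall>\<^sub>F n in sequentially. prob (E n) \<le> 8 * s / e\<^sup>2 / (real n - 1)"
      using bound by (auto simp: eventually_sequentially)
    show "(\<lambda>n. 8 * s / e\<^sup>2 / (real n - 1)) \<longlonglongrightarrow> 0"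
      by (intro real_tendsto_divide_at_top[OF tendsto_const]
            filterlim_tendsto_add_at_top[of "\<lambda>_. -1" "-1" sequentially real, simplified add.commute, simplified])
         (auto simp: filterlim_real_sequentially)
  qed auto
  then have "whp (\<lambda>n \<omega>. \<omega> \<notin> E n)" unfolding whp_def using Eev by auto
  \<comment> \<open>Without dyads, division by zero makes every \<open>zmean\<close> equal to 0, and
    centring inside the mean would differ from centring outside. The exceptional event is the whole
    space for these finitely many \<open>n\<close>.\<close>
  moreover have "whp (\<lambda>n \<omega>. n \<ge> 2)"
    unfolding whp_def
    by (intro exI[of _ "\<lambda>n. if n \<ge> 2 then {} else space M"])
       (auto intro!: tendsto_eventually simp: eventually_sequentially)
  ultimately have "whp (\<lambda>n \<omega>. \<omega> \<notin> E n \<and> n \<ge> 2)" by (rule whp_conj)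
  then show ?thesis
  proof (rule whp_mono)
    fix n \<omega> assume \<omega>: "\<omega> \<in> space M" and n: "\<omega> \<notin> E n \<and> 2 \<le> n"
    have "real (card (dyads n)) > 0" using n by (simp add: card_dyads)
    then have "zmean n ?g \<omega> = zmean n h \<omega> - ?m"
      by (simp add: zmean_eq sum_subtractf field_simps)
    moreover have "(zmean n ?g \<omega>)\<^sup>2 < e\<^sup>2" using n \<omega> by (auto simp: E_def)
    then have "\<bar>zmean n ?g \<omega>\<bar> < e" using e by (simp add: abs_le_square_iff[symmetric] not_le[symmetric])
    ultimately show "\<bar>zmean n h \<omega> - ?m\<bar> \<le> e" by simp
  qed
qed

end

subsection \<open>Bracketing of orthants\<close>

text \<open>Finite L1 bracketing numbers at every scale, for indicators of the sets in
  \<open>C\<close>. The bracketing sets must be measurable but need not belong to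
  \<open>C\<close>.\<close>

definition finitely_bracketed :: "'a measure \<Rightarrow> 'a set set \<Rightarrow> bool" where
  "finitely_bracketed N C \<longleftrightarrow> (\<forall>e>0. \<exists>B. finite B \<and>
     (\<forall>(L, R)\<in>B. L \<in> sets N \<and> R \<in> sets N \<and> measure N (R - L) \<le> e) \<and>
     (\<forall>A\<in>C. \<exists>(L, R)\<in>B. L \<subseteq> A \<and> A \<subseteq> R))"

text \<open>The punctured neighbourhoods shrink to the empty set, since level \<open>t\<close>
  itself is left out; continuity from above does the rest, whatever mass sits at
  \<open>t\<close>.\<close>

lemma (in finite_measure) measure_punctured_neighbourhood:
  fixes f :: "'a \<Rightarrow> real"
  assumes [measurable]: "f \<in> borel_measurable M" and e: "e > 0"
  shows "\<exists>d>0. measure M {y \<in> space M. t - d < f y \<and> f y < t} \<le> e \<and>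
    measure M {y \<in> space M. t < f y \<and> f y < t + d} \<le> e"
proof -
  define d where "d n = inverse (real (Suc n))" for n
  let ?A = "\<lambda>n. {y \<in> space M. t - d n < f y \<and> f y < t} \<union> {y \<in> space M. t < f y \<and> f y < t + d n}"
  have dec: "decseq d" unfolding d_def decseq_def by (auto simp: field_simps)
  have d0: "d \<longlonglongrightarrow> 0" unfolding d_def by (rule LIMSEQ_inverse_real_of_nat)
  have "\<not> (\<forall>n. y \<in> ?A n)" for y
  proof
    assume *: "\<forall>n. y \<in> ?A n"
    then have "f y \<noteq> t" by auto
    then have "eventually (\<lambda>n. d n < \<bar>f y - t\<bar>) sequentially"
      using d0 by (intro order_tendstoD) auto
    then obtain n where "d n < \<bar>f y - t\<bar>" by (auto simp: eventually_sequentially)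
    with *[rule_format, of n] show False by (auto simp: abs_if split: if_splits)
  qed
  then have "(\<Inter>n. ?A n) = {}" by blast
  moreover have "(\<lambda>n. measure M (?A n)) \<longlonglongrightarrow> measure M (\<Inter>n. ?A n)"
  proof (rule finite_Lim_measure_decseq)
    show "decseq ?A"
      unfolding decseq_def
    proof (intro allI impI)
      fix m n :: nat assume "m \<le> n"
      then have "d n \<le> d m" using dec by (auto simp: decseq_def)
      then show "?A n \<subseteq> ?A m" by auto
    qed
  qed auto
  ultimately have "(\<lambda>n. measure M (?A n)) \<longlonglongrightarrow> 0" by simp
  then have "eventually (\<lambda>n. measure M (?A n) < e) sequentially"
    using e by (rule order_tendstoD)
  then obtain n where n: "measure M (?A n) < e" by (auto simp: eventually_sequentially)
  have "measure M {y \<in> space M. t - d n < f y \<and> f y < t} \<le> measure M (?A n)"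
    "measure M {y \<in> space M. t < f y \<and> f y < t + d n} \<le> measure M (?A n)"
    by (auto intro!: finite_measure_mono)
  then show ?thesis using n by (intro exI[of _ "d n"]) (auto simp: d_def)
qed

text \<open>Atoms of the law of \<open>f\<close> cause no difficulty: a small punctured neighbourhood of \<open>t\<close> has small
  mass, so three brackets serve all levels near \<open>t\<close>, and compactness leaves finitely many \<open>t\<close>.\<close>

lemma (in finite_measure) finitely_bracketed_sublevel:
  fixes f :: "'a \<Rightarrow> real"
  assumes f[measurable]: "f \<in> borel_measurable M" and K: "compact K"
  shows "finitely_bracketed M ((\<lambda>t. {y \<in> space M. f y \<le> t}) ` K)"
  unfolding finitely_bracketed_def
proof (intro allI impI)
  fix e :: real assume e: "e > 0"
  let ?F = "\<lambda>t. {y \<in> space M. f y \<le> t}" and ?G = "\<lambda>t. {y \<in> space M. f y < t}"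
  have "\<forall>t. \<exists>d>0. measure M {y \<in> space M. t - d < f y \<and> f y < t} \<le> e \<and>
      measure M {y \<in> space M. t < f y \<and> f y < t + d} \<le> e"
    by (rule allI) (rule measure_punctured_neighbourhood[OF f e])
  from choice[OF this] obtain d where
    d0: "\<forall>t. d t > 0 \<and> measure M {y \<in> space M. t - d t < f y \<and> f y < t} \<le> e \<and>
       measure M {y \<in> space M. t < f y \<and> f y < t + d t} \<le> e" by (rule exE)
  have d: "d t > 0" "measure M {y \<in> space M. t - d t < f y \<and> f y < t} \<le> e"
       "measure M {y \<in> space M. t < f y \<and> f y < t + d t} \<le> e" for t
    using d0[THEN spec, of t] by simp_all
  have "K \<subseteq> (\<Union>t\<in>K. {t - d t<..<t + d t})"
  proof
    fix t assume "t \<in> K"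
    then show "t \<in> (\<Union>t\<in>K. {t - d t<..<t + d t})" using d(1)[of t] by (intro UN_I[of t]) simp_all
  qed
  then obtain T where T: "T \<subseteq> K" "finite T" "K \<subseteq> (\<Union>t\<in>T. {t - d t<..<t + d t})"
    using compactE_image[OF K, of K "\<lambda>t. {t - d t<..<t + d t}"] by (metis open_greaterThanLessThan)
  \<comment> \<open>One bracket each for levels below, equal to and above the centre
    \<open>t\<close>. In each of them the level set of \<open>t\<close> lies outside the gap between
    the two sides.\<close>
  let ?B = "(\<lambda>t. (?F (t - d t), ?G t)) ` T \<union> (\<lambda>t. (?F t, ?F t)) ` T \<union> (\<lambda>t. (?F t, ?G (t + d t))) ` T"
  have diff: "?G u - ?F t = {y \<in> space M. t < f y \<and> f y < u}" for t u by auto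
  show "\<exists>B. finite B \<and> (\<forall>(L, R)\<in>B. L \<in> sets M \<and> R \<in> sets M \<and> measure M (R - L) \<le> e) \<and>
      (\<forall>A\<in>?F ` K. \<exists>(L, R)\<in>B. L \<subseteq> A \<and> A \<subseteq> R)"
  proof (intro exI[of _ ?B] conjI ballI)
    show "finite ?B" using T(2) by auto
    fix p assume "p \<in> ?B"
    then show "case p of (L, R) \<Rightarrow> L \<in> sets M \<and> R \<in> sets M \<and> measure M (R - L) \<le> e"
      using d(2,3) less_imp_le[OF e] by (elim UnE imageE) (simp_all add: diff)
  next
    fix A assume "A \<in> ?F ` K"
    then obtain s where s: "s \<in> K" "A = ?F s" by auto
    then have "s \<in> (\<Union>t\<in>T. {t - d t<..<t + d t})" using T(3) by blast
    then obtain t where t: "t \<in> T" "t - d t < s" "s < t + d t" by (elim UN_E) simp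
    consider "s < t" | "s = t" | "s > t" by linarith
    then show "\<exists>(L, R)\<in>?B. L \<subseteq> A \<and> A \<subseteq> R"
    proof cases
      case 1
      then have sub: "?F (t - d t) \<subseteq> A \<and> A \<subseteq> ?G t" using t(2,3) unfolding s(2) by auto
      have "(?F (t - d t), ?G t) \<in> ?B"
        by (rule UnI1, rule UnI1, rule image_eqI[OF refl t(1)])
      then show ?thesis by (rule bexI[rotated]) (simp only: prod.case sub simp_thms)
    next
      case 2
      then have sub: "?F t \<subseteq> A \<and> A \<subseteq> ?F t" using t(2,3) unfolding s(2) by auto
      have "(?F t, ?F t) \<in> ?B"
        by (rule UnI1, rule UnI2, rule image_eqI[OF refl t(1)])
      then show ?thesis by (rule bexI[rotated]) (simp only: prod.case sub simp_thms)
    next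
      case 3
      then have sub: "?F t \<subseteq> A \<and> A \<subseteq> ?G (t + d t)" using t(2,3) unfolding s(2) by auto
      have "(?F t, ?G (t + d t)) \<in> ?B"
        by (rule UnI2, rule image_eqI[OF refl t(1)])
      then show ?thesis by (rule bexI[rotated]) (simp only: prod.case sub simp_thms)
    qed
  qed
qed

text \<open>Choose one bracket per coordinate and intersect both sides: a difference of
  intersections lies in the union of the differences. Hence the scale \<open>e / CARD('k)\<close>
  per coordinate, and finitely many choices in all.\<close>

lemma (in finite_measure) finitely_bracketed_INT:
  fixes C :: "'k::finite \<Rightarrow> 'a set set"
  assumes C: "\<And>k. finitely_bracketed M (C k)"
  shows "finitely_bracketed M {(\<Inter>k. A k) | A. \<forall>k. A k \<in> C k}"
  unfolding finitely_bracketed_def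
proof (intro allI impI)
  fix e :: real assume e: "e > 0"
  define e' where "e' = e / real CARD('k)"
  have "e' > 0" using e by (simp add: e'_def)
  then have "\<forall>k. \<exists>B. finite B \<and>
     (\<forall>(L, R)\<in>B. L \<in> sets M \<and> R \<in> sets M \<and> measure M (R - L) \<le> e') \<and>
     (\<forall>A\<in>C k. \<exists>(L, R)\<in>B. L \<subseteq> A \<and> A \<subseteq> R)"
    by (intro allI C[unfolded finitely_bracketed_def, rule_format])
  from choice[OF this] obtain B where B0: "\<forall>k. finite (B k) \<and>
     (\<forall>(L, R)\<in>B k. L \<in> sets M \<and> R \<in> sets M \<and> measure M (R - L) \<le> e') \<and>
     (\<forall>A\<in>C k. \<exists>(L, R)\<in>B k. L \<subseteq> A \<and> A \<subseteq> R)" by (rule exE)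
  have B: "finite (B k)"
     "(L, R) \<in> B k \<Longrightarrow> L \<in> sets M \<and> R \<in> sets M \<and> measure M (R - L) \<le> e'"
     "A \<in> C k \<Longrightarrow> \<exists>p\<in>B k. fst p \<subseteq> A \<and> A \<subseteq> snd p" for k L R A
  proof -
    note Bk = B0[THEN spec, of k]
    show "finite (B k)" using Bk by (rule conjunct1)
    show "L \<in> sets M \<and> R \<in> sets M \<and> measure M (R - L) \<le> e'" if "(L, R) \<in> B k"
      using bspec[OF Bk[THEN conjunct2, THEN conjunct1] that] by simp
    show "\<exists>p\<in>B k. fst p \<subseteq> A \<and> A \<subseteq> snd p" if "A \<in> C k"
    proof -
      have "\<exists>(L, R)\<in>B k. L \<subseteq> A \<and> A \<subseteq> R"
        using bspec[OF Bk[THEN conjunct2, THEN conjunct2] that] .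
      then show ?thesis by (simp add: case_prod_beta)
    qed
  qed
  let ?g = "\<lambda>s. ((\<Inter>k. fst (s k)), (\<Inter>k. snd (s k)))"
  let ?B = "?g ` (PiE UNIV B)"
  show "\<exists>B. finite B \<and> (\<forall>(L, R)\<in>B. L \<in> sets M \<and> R \<in> sets M \<and> measure M (R - L) \<le> e) \<and>
      (\<forall>A\<in>{(\<Inter>k. A k) | A. \<forall>k. A k \<in> C k}. \<exists>(L, R)\<in>B. L \<subseteq> A \<and> A \<subseteq> R)"
  proof (intro exI[of _ ?B] conjI ballI)
    show "finite ?B" using B(1) by (intro finite_imageI finite_PiE) auto
    fix p assume "p \<in> ?B"
    then obtain s where s: "p = ?g s" "s \<in> PiE UNIV B" by (rule imageE)
    then have sk: "fst (s k) \<in> sets M" "snd (s k) \<in> sets M" "measure M (snd (s k) - fst (s k)) \<le> e'" for k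
      using B(2)[of "fst (s k)" "snd (s k)" k] PiE_mem[OF s(2), of k] by simp_all
    have "measure M ((\<Inter>k. snd (s k)) - (\<Inter>k. fst (s k))) \<le> measure M (\<Union>k. snd (s k) - fst (s k))"
      using sk by (intro finite_measure_mono) auto
    also have "\<dots> \<le> (\<Sum>k\<in>UNIV. measure M (snd (s k) - fst (s k)))"
      using sk by (intro measure_UNION_le) auto
    also have "\<dots> \<le> (\<Sum>k\<in>(UNIV :: 'k set). e')" using sk by (intro sum_mono) auto
    also have "\<dots> = e" by (simp add: e'_def)
    finally show "case p of (L, R) \<Rightarrow> L \<in> sets M \<and> R \<in> sets M \<and> measure M (R - L) \<le> e"
      using sk s by auto
  next
    fix A assume "A \<in> {(\<Inter>k. A k) | A. \<forall>k. A k \<in> C k}"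
    then obtain A' where A: "A = (\<Inter>k. A' k)" "\<And>k. A' k \<in> C k" by auto
    have "\<forall>k. \<exists>p. p \<in> B k \<and> fst p \<subseteq> A' k \<and> A' k \<subseteq> snd p"
      using B(3)[OF A(2)] by (auto simp: Bex_def)
    from choice[OF this] obtain s where "\<forall>k. s k \<in> B k \<and> fst (s k) \<subseteq> A' k \<and> A' k \<subseteq> snd (s k)"
      by (rule exE)
    then have s: "\<And>k. s k \<in> B k" "\<And>k. fst (s k) \<subseteq> A' k \<and> A' k \<subseteq> snd (s k)" by simp_all
    then have mem: "?g s \<in> ?B" by (intro imageI) (simp add: PiE_UNIV_domain)
    have sub: "(\<Inter>k. fst (s k)) \<subseteq> A \<and> A \<subseteq> (\<Inter>k. snd (s k))"
      unfolding A(1) using s(2) by blast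
    show "\<exists>(L, R)\<in>?B. L \<subseteq> A \<and> A \<subseteq> R"
      using mem by (rule bexI[rotated]) (simp only: prod.case sub simp_thms)
  qed
qed

text \<open>An orthant is the intersection of its coordinate half-spaces, whose levels range over
  the compact intervals \<open>{a $ k..b $ k}\<close>.\<close>

lemma finitely_bracketed_orthants:
  fixes N :: "(real ^ 'd) measure"
  assumes "finite_measure N" and sN: "sets N = sets borel"
  shows "finitely_bracketed N (atMost ` cbox a b)"
proof -
  interpret finite_measure N by fact
  have space: "space N = UNIV" using sets_eq_imp_space_eq[OF sN] by simp
  let ?C = "\<lambda>k. (\<lambda>t. {y \<in> space N. y $ k \<le> t}) ` {a $ k..b $ k}"
  have "finitely_bracketed N (?C k)" for k
    by (rule finitely_bracketed_sublevel) (simp_all add: measurable_cong_sets[OF sN refl])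
  then have *: "finitely_bracketed N {(\<Inter>k. A k) | A. \<forall>k. A k \<in> ?C k}"
    by (rule finitely_bracketed_INT)
  have "atMost ` cbox a b \<subseteq> {(\<Inter>k. A k) | A. \<forall>k. A k \<in> ?C k}"
  proof safe
    fix x assume "x \<in> cbox a b"
    then show "\<exists>A. {..x} = (\<Inter>k. A k) \<and> (\<forall>k. A k \<in> ?C k)"
      by (intro exI[of _ "\<lambda>k. {y. y $ k \<le> x $ k}"])
         (auto simp: space less_eq_vec_def interval_cbox_cart[symmetric])
  qed
  with * show ?thesis
    unfolding finitely_bracketed_def by (meson subsetD)
qed

subsection \<open>Stability of linear systems\<close>

text \<open>Eigenvectors of a symmetric matrix for distinct eigenvalues are orthogonal, hence
  independent. Finiteness is what makes the \<open>Min\<close> in \<open>smallest_eigenvalue\<close>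
  a lower bound.\<close>

lemma finite_eigenvalues:
  fixes A :: "real ^ 'd ^ 'd"
  assumes sym: "transpose A = A"
  shows "finite {l. \<exists>v. v \<noteq> 0 \<and> A *v v = l *\<^sub>R v}"
proof -
  let ?L = "{l. \<exists>v. v \<noteq> 0 \<and> A *v v = l *\<^sub>R v}"
  have "\<forall>l\<in>?L. \<exists>v. v \<noteq> 0 \<and> A *v v = l *\<^sub>R v" by simp
  from bchoice[OF this] obtain v where v0: "\<forall>l\<in>?L. v l \<noteq> 0 \<and> A *v v l = l *\<^sub>R v l" by (rule exE)
  note v = v0[rule_format]
  have orth: "v l \<bullet> v m = 0" if "l \<in> ?L" "m \<in> ?L" "l \<noteq> m" for l m
  proof -
    have "l * (v l \<bullet> v m) = (A *v v l) \<bullet> v m"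
      unfolding v[OF that(1), THEN conjunct2] by simp
    also have "\<dots> = (transpose A *v v l) \<bullet> v m" by (simp add: sym)
    also have "\<dots> = v l \<bullet> (A *v v m)" by (simp only: transpose_matrix_vector dot_lmul_matrix)
    also have "\<dots> = m * (v l \<bullet> v m)"
      unfolding v[OF that(2), THEN conjunct2] by simp
    finally show ?thesis using that(3) by simp
  qed
  have inj: "inj_on v ?L"
  proof (rule inj_onI, rule ccontr)
    fix l m assume lm: "l \<in> ?L" "m \<in> ?L" "v l = v m" "l \<noteq> m"
    from orth[OF lm(1,2,4)] lm(3) have "v l = 0" by simp
    with v[OF lm(1)] show False by simp
  qed
  have "pairwise orthogonal (v ` ?L)" 
    unfolding orthogonal_def by (rule pairwise_imageI) (rule orth)
  moreover have "0 \<notin> v ` ?L"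
  proof
    assume "0 \<in> v ` ?L"
    then obtain l where "l \<in> ?L" "0 = v l" by (rule imageE)
    with v[of l] show False by simp
  qed
  ultimately have "independent (v ` ?L)" by (rule pairwise_orthogonal_independent)
  then have "finite (v ` ?L)" by (rule independent_imp_finite)
  then show ?thesis using inj by (rule finite_imageD)
qed

text \<open>A nonzero kernel vector would make 0 an eigenvalue, so the minimum could not be
  positive.\<close>

lemma nonsingular_if_smallest_eigenvalue_pos:
  fixes A :: "real ^ 'd ^ 'd"
  assumes "transpose A = A" "0 < smallest_eigenvalue A" "A *v v = 0"
  shows "v = 0"
proof (rule ccontr)
  assume "v \<noteq> 0"
  with assms have "0 \<in> {l. \<exists>v. v \<noteq> 0 \<and> A *v v = l *\<^sub>R v}" by auto
  then have "smallest_eigenvalue A \<le> 0"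
    unfolding smallest_eigenvalue_def by (rule Min_le[OF finite_eigenvalues[OF assms(1)]])
  with assms show False by simp
qed

lemma invertible_if_nonsingular:
  fixes A :: "real ^ 'd ^ 'd"
  assumes "\<And>v. A *v v = 0 \<Longrightarrow> v = 0"
  shows "invertible A"
  using assms by (simp add: invertible_left_inverse matrix_left_invertible_ker)

lemma norm_mult_vec_le:
  fixes A :: "real ^ 'd ^ 'd"
  assumes "\<And>k l. \<bar>A $ k $ l\<bar> \<le> \<eta>"
  shows "norm (A *v v) \<le> real CARD('d) ^ 2 * \<eta> * norm v"
proof -
  have \<eta>: "\<eta> \<ge> 0" using assms order_trans[OF abs_ge_zero] by blast
  have c: "\<bar>(A *v v) $ k\<bar> \<le> real CARD('d) * \<eta> * norm v" for k
  proof -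
    have "\<bar>(A *v v) $ k\<bar> \<le> (\<Sum>l\<in>UNIV. \<bar>A $ k $ l * v $ l\<bar>)"
      by (simp add: matrix_vector_mult_def)
    also have "\<dots> \<le> (\<Sum>l\<in>(UNIV :: 'd set). \<eta> * norm v)"
      unfolding abs_mult using assms component_le_norm_cart \<eta> by (intro sum_mono mult_mono) auto
    finally show ?thesis by (simp add: mult_ac)
  qed
  have "norm (A *v v) \<le> (\<Sum>k\<in>UNIV. \<bar>(A *v v) $ k\<bar>)" by (rule norm_le_l1_cart)
  also have "\<dots> \<le> (\<Sum>k\<in>(UNIV :: 'd set). real CARD('d) * \<eta> * norm v)" by (intro sum_mono c)
  finally show ?thesis by (simp add: power2_eq_square mult_ac)
qed

text \<open>A nonsingular \<open>Q\<close> expands norms by at least some \<open>B > 0\<close>; a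
  perturbation of operator norm at most \<open>B / 2\<close> leaves expansion by
  \<open>B / 2\<close>. The error of the solution is then read off from its image under
  \<open>Q'\<close>.\<close>

lemma least_squares_stable:
  fixes Q :: "real ^ 'd ^ 'd" and m :: "real ^ 'd"
  assumes ns: "\<And>v. Q *v v = 0 \<Longrightarrow> v = 0" and e: "e > 0"
  shows "\<exists>\<eta>>0. \<forall>Q' m' \<beta>'. (\<forall>k l. \<bar>Q' $ k $ l - Q $ k $ l\<bar> \<le> \<eta>) \<longrightarrow> (\<forall>k. \<bar>m' $ k - m $ k\<bar> \<le> \<eta>) \<longrightarrow>
     (invertible Q' \<longrightarrow> \<beta>' = matrix_inv Q' *v m') \<longrightarrow> norm (\<beta>' - matrix_inv Q *v m) \<le> e"
proof -
  define \<beta> where "\<beta> = matrix_inv Q *v m"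
  define D where "D = real CARD('d)"
  have D: "D > 0" by (simp add: D_def)
  have inv: "A *v (matrix_inv A *v x) = x" if "invertible A" for A :: "real ^ 'd ^ 'd" and x
  proof -
    have "\<exists>B. A ** B = mat 1 \<and> B ** A = mat 1" using that by (simp add: invertible_def)
    then have "A ** matrix_inv A = mat 1" unfolding matrix_inv_def by (rule someI2_ex) blast
    then show ?thesis by (simp add: matrix_vector_mul_assoc)
  qed
  have Q\<beta>: "Q *v \<beta> = m" unfolding \<beta>_def by (rule inv[OF invertible_if_nonsingular[OF ns]])
  have "inj ((*v) Q)"
    using ns by (simp add: vec.inj_iff_eq_0)
  then obtain B where B: "B > 0" "\<And>v. B * norm v \<le> norm (Q *v v)"
    using linear_inj_bounded_below_pos[of "(*v) Q"] by (auto simp: mult.commute)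
  \<comment> \<open>\<open>W * \<eta>\<close> bounds the right-hand side of the error equation:
    \<open>D * \<eta>\<close> from the vector and \<open>D\<^sup>2 * \<eta> * norm \<beta>\<close>
    from the matrix.\<close>
  define W where "W = D + D\<^sup>2 * norm \<beta>"
  have W: "W > 0" using D by (simp add: W_def add_pos_nonneg)
  \<comment> \<open>The first bound keeps the matrix perturbation below \<open>B / 2\<close>, the
    second makes the right-hand side at most \<open>e * B / 2\<close>.\<close>
  define \<eta> where "\<eta> = min (B / (2 * D\<^sup>2)) (e * B / (2 * W))"
  have \<eta>: "\<eta> > 0" using B(1) D W e by (simp add: \<eta>_def)
  have \<eta>1: "D\<^sup>2 * \<eta> \<le> B / 2"
  proof -
    have "\<eta> \<le> B / (2 * D\<^sup>2)" by (simp add: \<eta>_def)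
    then show ?thesis using D by (simp add: field_simps)
  qed
  have \<eta>2: "W * \<eta> \<le> e * B / 2"
  proof -
    have "\<eta> \<le> e * B / (2 * W)" by (simp add: \<eta>_def)
    then show ?thesis using W by (simp add: field_simps)
  qed
  show ?thesis
  proof (intro exI[of _ \<eta>] conjI allI impI \<eta>)
    fix Q' :: "real ^ 'd ^ 'd" and m' \<beta>'
    assume Q': "\<forall>k l. \<bar>Q' $ k $ l - Q $ k $ l\<bar> \<le> \<eta>" and m': "\<forall>k. \<bar>m' $ k - m $ k\<bar> \<le> \<eta>"
      and \<beta>': "invertible Q' \<longrightarrow> \<beta>' = matrix_inv Q' *v m'"
    have diff: "norm ((Q' - Q) *v v) \<le> D\<^sup>2 * \<eta> * norm v" for v
      unfolding D_def using Q' by (intro norm_mult_vec_le) simp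
    have low: "B / 2 * norm v \<le> norm (Q' *v v)" for v
    proof -
      have "B * norm v \<le> norm (Q' *v v - (Q' - Q) *v v)"
        using B(2)[of v] by (simp add: matrix_vector_mult_diff_rdistrib)
      also have "\<dots> \<le> norm (Q' *v v) + norm ((Q' - Q) *v v)" by (rule norm_triangle_ineq4)
      also have "norm ((Q' - Q) *v v) \<le> B / 2 * norm v"
        using diff[of v] mult_right_mono[OF \<eta>1, of "norm v"] by simp
      finally show ?thesis by (simp add: field_simps)
    qed
    \<comment> \<open>This discharges the premise on \<open>\<beta>'\<close>, which says nothing
      about singular \<open>Q'\<close>.\<close>
    have "invertible Q'"
    proof (rule invertible_if_nonsingular)
      fix v assume "Q' *v v = 0"
      with low[of v] B(1) show "v = 0" by (simp add: mult_le_0_iff)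
    qed
    then have "Q' *v \<beta>' = m'" using \<beta>' inv by simp
    then have "Q' *v (\<beta>' - \<beta>) = (m' - m) - (Q' - Q) *v \<beta>"
      using Q\<beta> by (simp add: matrix_vector_mult_diff_rdistrib matrix_vector_mult_diff_distrib)
    then have "B / 2 * norm (\<beta>' - \<beta>) \<le> norm ((m' - m) - (Q' - Q) *v \<beta>)"
      using low[of "\<beta>' - \<beta>"] by simp
    also have "\<dots> \<le> norm (m' - m) + norm ((Q' - Q) *v \<beta>)" by (rule norm_triangle_ineq4)
    also have "norm (m' - m) \<le> D * \<eta>"
    proof -
      have "norm (m' - m) \<le> (\<Sum>k\<in>UNIV. \<bar>(m' - m) $ k\<bar>)" by (rule norm_le_l1_cart)
      also have "\<dots> \<le> (\<Sum>k\<in>(UNIV :: 'd set). \<eta>)" using m' by (intro sum_mono) simp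
      finally show ?thesis by (simp add: D_def)
    qed
    also note diff[of \<beta>]
    also have "D * \<eta> + D\<^sup>2 * \<eta> * norm \<beta> = W * \<eta>" by (simp add: W_def algebra_simps)
    also note \<eta>2
    finally have "B * norm (\<beta>' - \<beta>) \<le> B * e" by (simp add: field_simps)
    then show "norm (\<beta>' - matrix_inv Q *v m) \<le> e" using B(1) by (simp add: \<beta>_def)
  qed
qed

subsection \<open>Suprema over the rectangle\<close>

text \<open>The supremum is 1-Lipschitz in the uniform distance. Boundedness matters because a real
  \<open>SUP\<close> over an unbounded set has no meaning; for \<open>f\<close> it is inherited from
  \<open>g\<close>.\<close>

lemma abs_SUP_diff_le:
  fixes f g :: "'a \<Rightarrow> real"
  assumes "K \<noteq> {}" and g: "bdd_above (g ` K)" and fg: "\<And>x. x \<in> K \<Longrightarrow> \<bar>f x - g x\<bar> \<le> e"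
  shows "\<bar>(SUP x\<in>K. f x) - (SUP x\<in>K. g x)\<bar> \<le> e"
proof -
  have f: "bdd_above (f ` K)"
  proof -
    obtain c where "\<And>x. x \<in> K \<Longrightarrow> g x \<le> c" using g by (auto simp: bdd_above_def)
    then show ?thesis using fg by (intro bdd_aboveI2[of _ _ "c + e"]) (smt (verit))
  qed
  have "(SUP x\<in>K. f x) \<le> (SUP x\<in>K. g x) + e"
  proof (rule cSUP_least[OF assms(1)])
    fix x assume "x \<in> K"
    with fg[of x] cSUP_upper[OF _ g, of x] show "f x \<le> (SUP x\<in>K. g x) + e" by linarith
  qed
  moreover have "(SUP x\<in>K. g x) \<le> (SUP x\<in>K. f x) + e"
  proof (rule cSUP_least[OF assms(1)])
    fix x assume "x \<in> K"
    with fg[of x] cSUP_upper[OF _ f, of x] show "g x \<le> (SUP x\<in>K. f x) + e" by linarith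
  qed
  ultimately show ?thesis by linarith
qed

text \<open>The witness has rational coordinates, except where \<open>t\<close> sits on the upper face.\<close>

lemma countable_orthant_witnesses:
  fixes a b :: "real ^ 'd"
  obtains D where "countable D" "D \<subseteq> cbox a b"
    "\<And>t P. t \<in> cbox a b \<Longrightarrow> finite P \<Longrightarrow> P \<subseteq> cbox a b \<Longrightarrow> \<exists>t'\<in>D. \<forall>p\<in>P. p \<le> t' \<longleftrightarrow> p \<le> t"
proof
  let ?D = "cbox a b \<inter> {x. \<forall>k. x $ k \<in> insert (b $ k) \<rat>}"
  have "countable {x :: real ^ 'd. \<forall>k. x $ k \<in> insert (b $ k) \<rat>}"
    by (intro countable_vector) (simp add: countable_rat)
  then show "countable ?D" by (rule countable_subset[rotated]) auto
  show "?D \<subseteq> cbox a b" by auto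
  fix t P assume t: "t \<in> cbox a b" and P: "finite P" "P \<subseteq> cbox a b"
  have "\<exists>s. s \<in> insert (b $ k) \<rat> \<and> t $ k \<le> s \<and> s \<le> b $ k \<and> (\<forall>p\<in>P. p $ k \<le> s \<longleftrightarrow> p $ k \<le> t $ k)" for k
  proof (cases "t $ k = b $ k")
    case True
    then show ?thesis by auto
  next
    case False
    \<comment> \<open>Raising \<open>t $ k\<close> to a rational short of the next larger coordinate
      in \<open>P\<close> flips no comparison. Inserting \<open>b $ k\<close> makes the set nonempty
      and keeps the witness inside the box.\<close>
    let ?S = "insert (b $ k) ((\<lambda>p. p $ k) ` {p\<in>P. t $ k < p $ k})"
    have fin: "finite ?S" using P by simp
    have "t $ k < Min ?S"
      using False t fin by (subst Min_gr_iff) (auto simp: interval_cbox_cart[symmetric] less_eq_vec_def less_le)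
    then obtain s where s: "s \<in> \<rat>" "t $ k < s" "s < Min ?S" using Rats_dense_in_real by blast
    then have "s < x" if "x \<in> ?S" for x using Min_le[OF fin that] by linarith
    then have *: "s < b $ k" "\<And>p. p \<in> P \<Longrightarrow> t $ k < p $ k \<Longrightarrow> s < p $ k" by auto
    have "p $ k \<le> s \<longleftrightarrow> p $ k \<le> t $ k" if "p \<in> P" for p
      using *(2)[OF that] s(2) by linarith
    then show ?thesis using s *(1) by (intro exI[of _ s]) auto
  qed
  then have "\<forall>k. \<exists>s. s \<in> insert (b $ k) \<rat> \<and> t $ k \<le> s \<and> s \<le> b $ k \<and>
      (\<forall>p\<in>P. p $ k \<le> s \<longleftrightarrow> p $ k \<le> t $ k)" by blast
  from choice[OF this] obtain s where s: "\<And>k. s k \<in> insert (b $ k) \<rat>" "\<And>k. t $ k \<le> s k"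
    "\<And>k. s k \<le> b $ k" "\<And>k p. p \<in> P \<Longrightarrow> p $ k \<le> s k \<longleftrightarrow> p $ k \<le> t $ k" by blast
  show "\<exists>t'\<in>?D. \<forall>p\<in>P. p \<le> t' \<longleftrightarrow> p \<le> t"
    using s t by (intro bexI[of _ "\<chi> k. s k"])
      (auto simp: interval_cbox_cart[symmetric] less_eq_vec_def intro: order_trans)
qed

section \<open>A weak law uniform over a bracketed class of sets\<close>

context dyadic_sampling
begin

lemma zmean_abs_le:
  assumes "\<And>z. \<bar>f z\<bar> \<le> g z"
  shows "\<bar>zmean n f \<omega>\<bar> \<le> zmean n g \<omega>"
  unfolding zmean_eq abs_divide abs_of_nat
  by (intro divide_right_mono order_trans[OF sum_abs] sum_mono assms) auto

lemma zmean_diff: "zmean n (\<lambda>z. f z - g z) \<omega> = zmean n f \<omega> - zmean n g \<omega>"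
  by (simp add: zmean_eq sum_subtractf diff_divide_distrib)

lemma zmean_abs_le_const:
  assumes "c \<ge> 0" "\<And>p. p \<in> dyads n \<Longrightarrow> \<bar>f (Z p \<omega>)\<bar> \<le> c"
  shows "\<bar>zmean n f \<omega>\<bar> \<le> c"
proof -
  have "\<bar>\<Sum>p\<in>dyads n. f (Z p \<omega>)\<bar> \<le> (\<Sum>p\<in>dyads n. c)"
    by (rule order_trans[OF sum_abs sum_mono[OF assms(2)]])
  then show ?thesis
    using assms(1) unfolding zmean_eq abs_divide abs_of_nat
    by (cases "card (dyads n) = 0") (simp_all add: field_simps)
qed

text \<open>As \<open>g\<close> changes sign, its integral is not monotone in the set. Instead
  \<open>A\<close> is compared with its lower bracket \<open>L\<close>: the two differ only inside
  \<open>R - L\<close>, at a cost of \<open>\<bar>g\<bar>\<close> there. So finitely many weak laws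
  are enough, for \<open>g\<close> on the sets \<open>L\<close> and for \<open>\<bar>g\<bar>\<close>
  on the gaps; weighting the bracketing measure by \<open>\<bar>g\<bar>\<close> makes the mean over
  a gap small.\<close>

lemma uniform_weak_law:
  fixes g :: "real \<times> (real ^ 'd) \<Rightarrow> real" and C :: "(real ^ 'd) set set"
  assumes g[measurable]: "g \<in> borel_measurable borel"
    and sq: "integrable M (\<lambda>\<omega>. (g (Z (1, 2) \<omega>))\<^sup>2)"
    and C: "finitely_bracketed
      (distr (density M (\<lambda>\<omega>. ennreal \<bar>g (Z (1, 2) \<omega>)\<bar>)) borel (\<lambda>\<omega>. snd (Z (1, 2) \<omega>))) C"
      "C \<subseteq> sets borel"
    and e: "e > 0"
  shows "whp (\<lambda>n \<omega>. \<forall>A\<in>C. \<bar>zmean n (\<lambda>z. g z * indicator A (snd z)) \<omega> -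
      expectation (\<lambda>\<omega>. g (Z (1, 2) \<omega>) * indicator A (snd (Z (1, 2) \<omega>)))\<bar> \<le> e)"
proof -
  define W where "W = Z (1, 2)"
  have W[measurable]: "W \<in> borel_measurable M" unfolding W_def by (rule measurable_Z) simp
  have snd_m[measurable]: "(snd :: real \<times> (real ^ 'd) \<Rightarrow> real ^ 'd) \<in> borel_measurable borel"
    by (intro borel_measurable_continuous_onI continuous_intros)
  have gi: "integrable M (\<lambda>\<omega>. g (W \<omega>))"
    unfolding W_def by (rule square_integrable_imp_integrable[OF _ sq]) (use W[unfolded W_def] in measurable)
  have ind[measurable]: "(\<lambda>z :: real \<times> (real ^ 'd). indicator A (snd z) :: real) \<in> borel_measurable borel"
    if "A \<in> sets borel" for A :: "(real ^ 'd) set"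
    by (rule measurable_compose[OF snd_m borel_measurable_indicator[OF that]])
  have indW[measurable]: "(\<lambda>\<omega>. indicator A (snd (W \<omega>)) :: real) \<in> borel_measurable M"
    if "A \<in> sets borel" for A :: "(real ^ 'd) set"
    using measurable_compose[OF W ind[OF that]] .
  have giA: "integrable M (\<lambda>\<omega>. g (W \<omega>) * indicator A (snd (W \<omega>)))"
    if "A \<in> sets borel" for A :: "(real ^ 'd) set"
    using that by (intro Bochner_Integration.integrable_bound[OF gi]) (auto simp: indicator_def)
  have gabs: "integrable M (\<lambda>\<omega>. \<bar>g (W \<omega>)\<bar> * indicator A (snd (W \<omega>)))"
    if "A \<in> sets borel" for A :: "(real ^ 'd) set"
    using that by (intro Bochner_Integration.integrable_bound[OF gi]) (auto simp: indicator_def)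
  let ?N = "distr (density M (\<lambda>\<omega>. ennreal \<bar>g (W \<omega>)\<bar>)) borel (\<lambda>\<omega>. snd (W \<omega>))"
  let ?E = "\<lambda>A. expectation (\<lambda>\<omega>. g (W \<omega>) * indicator A (snd (W \<omega>)))"
  let ?F = "\<lambda>A. expectation (\<lambda>\<omega>. \<bar>g (W \<omega>)\<bar> * indicator A (snd (W \<omega>)))"
  have N: "measure ?N A = ?F A" if A[measurable]: "A \<in> sets borel" for A :: "(real ^ 'd) set"
  proof -
    have sW[measurable]: "(\<lambda>\<omega>. snd (W \<omega>)) \<in> borel_measurable M" by measurable
    have s: "(\<lambda>\<omega>. snd (W \<omega>)) -` A \<inter> space M \<in> sets M" by measurable
    have "emeasure ?N A = emeasure (density M (\<lambda>\<omega>. ennreal \<bar>g (W \<omega>)\<bar>)) ((\<lambda>\<omega>. snd (W \<omega>)) -` A \<inter> space M)"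
      by (subst emeasure_distr) auto
    also have "\<dots> = (\<integral>\<^sup>+\<omega>. ennreal \<bar>g (W \<omega>)\<bar> * indicator ((\<lambda>\<omega>. snd (W \<omega>)) -` A \<inter> space M) \<omega> \<partial>M)"
      using s by (intro emeasure_density) auto
    also have "\<dots> = (\<integral>\<^sup>+\<omega>. ennreal (\<bar>g (W \<omega>)\<bar> * indicator A (snd (W \<omega>))) \<partial>M)"
      by (intro nn_integral_cong) (auto simp: indicator_def)
    also have "\<dots> = ennreal (?F A)"
      by (intro nn_integral_eq_integral gabs A) auto
    finally show ?thesis by (simp add: measure_def integral_nonneg_AE)
  qed
  \<comment> \<open>Four quarters: the weak law on \<open>L\<close>, the weak law on the gap, and
    the mean over the gap twice, once in bounding its sample version and once between the
    expectations for \<open>A\<close> and \<open>L\<close>.\<close>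
  have e4: "e / 4 > 0" using e by simp
  obtain B where B: "finite B"
      "\<And>L R. (L, R) \<in> B \<Longrightarrow> L \<in> sets borel \<and> R \<in> sets borel \<and> ?F (R - L) \<le> e / 4"
      "\<And>A. A \<in> C \<Longrightarrow> \<exists>(L, R)\<in>B. L \<subseteq> A \<and> A \<subseteq> R"
  proof -
    from C(1)[folded W_def, unfolded finitely_bracketed_def, rule_format, OF e4]
    obtain B where B: "finite B \<and> (\<forall>(L, R)\<in>B. L \<in> sets ?N \<and> R \<in> sets ?N \<and> measure ?N (R - L) \<le> e / 4) \<and>
      (\<forall>A\<in>C. \<exists>(L, R)\<in>B. L \<subseteq> A \<and> A \<subseteq> R)" by (rule exE)
    show ?thesis
    proof (rule that)
      show "finite B" using B by (rule conjunct1)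
      fix L R assume LR: "(L, R) \<in> B"
      then have "L \<in> sets ?N \<and> R \<in> sets ?N \<and> measure ?N (R - L) \<le> e / 4"
        using bspec[OF B[THEN conjunct2, THEN conjunct1] LR] by simp
      then show "L \<in> sets borel \<and> R \<in> sets borel \<and> ?F (R - L) \<le> e / 4"
        using N[of "R - L"] by auto
    next
      fix A assume "A \<in> C"
      then show "\<exists>(L, R)\<in>B. L \<subseteq> A \<and> A \<subseteq> R" by (rule bspec[OF B[THEN conjunct2, THEN conjunct2]])
    qed
  qed
  let ?P = "\<lambda>p n \<omega>. \<bar>zmean n (\<lambda>z. g z * indicator (fst p) (snd z)) \<omega> - ?E (fst p)\<bar> \<le> e / 4 \<and>
    \<bar>zmean n (\<lambda>z. \<bar>g z\<bar> * indicator (snd p - fst p) (snd z)) \<omega> - ?F (snd p - fst p)\<bar> \<le> e / 4"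
  have "whp (\<lambda>n \<omega>. \<forall>p\<in>B. ?P p n \<omega>)"
  proof (rule whp_ball_finite[OF B(1)])
    fix p assume p: "p \<in> B"
    have L[measurable]: "fst p \<in> sets borel" and R[measurable]: "snd p - fst p \<in> sets borel"
      using B(2)[of "fst p" "snd p"] p by auto
    have sqb: "integrable M (\<lambda>\<omega>. (h (Z (1, 2) \<omega>))\<^sup>2)"
      if [measurable]: "h \<in> borel_measurable borel" and le: "\<And>z. \<bar>h z\<bar> \<le> \<bar>g z\<bar>" for h :: "real \<times> (real ^ 'd) \<Rightarrow> real"
    proof (rule Bochner_Integration.integrable_bound[OF sq])
      show "(\<lambda>\<omega>. (h (Z (1, 2) \<omega>))\<^sup>2) \<in> borel_measurable M"
        unfolding W_def[symmetric] by measurable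
      show "AE \<omega> in M. norm ((h (Z (1, 2) \<omega>))\<^sup>2) \<le> norm ((g (Z (1, 2) \<omega>))\<^sup>2)"
        using le by (auto simp: abs_le_square_iff)
    qed
    have m1: "(\<lambda>z. g z * indicator (fst p) (snd z)) \<in> borel_measurable borel"
      using ind[OF L] by measurable
    have m2: "(\<lambda>z. \<bar>g z\<bar> * indicator (snd p - fst p) (snd z)) \<in> borel_measurable borel"
      using ind[OF R] by measurable
    show "whp (?P p)"
      unfolding W_def
      by (intro whp_conj weak_law m1 m2 sqb e4) (auto simp: indicator_def)
  qed
  then show ?thesis unfolding W_def[symmetric]
  proof (rule whp_mono, intro ballI)
    fix n \<omega> A assume P: "\<forall>p\<in>B. ?P p n \<omega>" and A: "A \<in> C"
    from B(3)[OF A] obtain p where "p \<in> B" "case p of (L, R) \<Rightarrow> L \<subseteq> A \<and> A \<subseteq> R" by (rule bexE)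
    then obtain L R where LR: "(L, R) \<in> B" "L \<subseteq> A" "A \<subseteq> R" by (cases p) simp
    note m = B(2)[OF LR(1)]
    have Am: "A \<in> sets borel" using A C(2) by blast
    have RLm: "R - L \<in> sets borel" using m by (intro sets.Diff) simp_all
    from bspec[OF P LR(1)]
    have 1: "\<bar>zmean n (\<lambda>z. g z * indicator L (snd z)) \<omega> - ?E L\<bar> \<le> e / 4"
      and 2: "\<bar>zmean n (\<lambda>z. \<bar>g z\<bar> * indicator (R - L) (snd z)) \<omega> - ?F (R - L)\<bar> \<le> e / 4"
      by simp_all
    have pt: "\<bar>g z * indicator A (snd z) - g z * indicator L (snd z)\<bar> \<le> \<bar>g z\<bar> * indicator (R - L) (snd z)" for z
      using LR(2,3) by (auto simp: indicator_def)
    have 3: "\<bar>zmean n (\<lambda>z. g z * indicator A (snd z)) \<omega> - zmean n (\<lambda>z. g z * indicator L (snd z)) \<omega>\<bar> \<le>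
        zmean n (\<lambda>z. \<bar>g z\<bar> * indicator (R - L) (snd z)) \<omega>"
      unfolding zmean_diff[symmetric] by (rule zmean_abs_le) (rule pt)
    have iA: "integrable M (\<lambda>\<omega>. g (W \<omega>) * indicator A (snd (W \<omega>)))" by (rule giA[OF Am])
    have iL: "integrable M (\<lambda>\<omega>. g (W \<omega>) * indicator L (snd (W \<omega>)))" using m by (intro giA) simp
    have "?E A - ?E L = expectation (\<lambda>\<omega>. g (W \<omega>) * indicator A (snd (W \<omega>)) - g (W \<omega>) * indicator L (snd (W \<omega>)))"
      by (rule Bochner_Integration.integral_diff[symmetric, OF iA iL])
    also have "\<bar>\<dots>\<bar> \<le> expectation (\<lambda>\<omega>. \<bar>g (W \<omega>) * indicator A (snd (W \<omega>)) - g (W \<omega>) * indicator L (snd (W \<omega>))\<bar>)"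
      by (rule integral_abs_bound)
    also have "\<dots> \<le> ?F (R - L)"
      by (intro integral_mono integrable_abs Bochner_Integration.integrable_diff iA iL gabs RLm pt)
    finally have 4: "\<bar>?E A - ?E L\<bar> \<le> ?F (R - L)" .
    have 5: "?F (R - L) \<le> e / 4" using m by simp
    show "\<bar>zmean n (\<lambda>z. g z * indicator A (snd z)) \<omega> - ?E A\<bar> \<le> e"
      using 1 2 3 4 5 by linarith
  qed
qed

end

text \<open>Dynkin's pi-lambda argument: orthants intersect in the orthant at the coordinatewise
  infimum and generate the Borel sets, and the sets with zero integral form a Dynkin system,
  \<open>total\<close> giving closure under complements.\<close>

lemma borel_integral_zero_if_orthants:
  fixes X :: "'w \<Rightarrow> real ^ 'd" and f :: "'w \<Rightarrow> real"
  assumes f: "integrable M f" and [measurable]: "X \<in> borel_measurable M"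
    and total: "(\<integral>\<omega>. f \<omega> \<partial>M) = 0"
    and orthant: "\<And>x. (\<integral>\<omega>. f \<omega> * indicator {..x} (X \<omega>) \<partial>M) = 0"
    and A: "A \<in> sets borel"
  shows "(LINT \<omega>:X -` A \<inter> space M|M. f \<omega>) = 0"
proof -
  have *: "A \<in> sigma_sets UNIV (range (\<lambda>a. {..a :: real ^ 'd}))"
    using A unfolding borel_eq_atMost by (simp add: sets_measure_of)
  have stable: "Int_stable (range (\<lambda>a. {..a :: real ^ 'd}))"
  proof (rule Int_stableI)
    fix a b assume "a \<in> range (\<lambda>a. {..a :: real ^ 'd})" "b \<in> range (\<lambda>a. {..a :: real ^ 'd})"
    then obtain x y where "a = {..x}" "b = {..y}" by auto
    then have "a \<inter> b = {..inf x y}" by auto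
    then show "a \<inter> b \<in> range (\<lambda>a. {..a :: real ^ 'd})" by auto
  qed
  have borel: "B \<in> sets borel" if "B \<in> sigma_sets UNIV (range (\<lambda>a. {..a :: real ^ 'd}))" for B
    using that unfolding borel_eq_atMost by (simp add: sets_measure_of)
  have int: "set_integrable M B f" if "B \<in> sets M" for B
    using f that unfolding set_integrable_def by (rule integrable_mult_indicator[rotated])
  have UN: "(LINT \<omega>:space M|M. f \<omega>) = 0"
    using total by (simp add: set_integral_space[OF f])
  show ?thesis
    using stable subset_UNIV[THEN PowI, THEN subsetI] *
  proof (induction A rule: sigma_sets_induct_disjoint)
    case (basic B)
    then obtain x where x: "B = {..x}" by auto
    have "(LINT \<omega>:X -` B \<inter> space M|M. f \<omega>) = (\<integral>\<omega>. f \<omega> * indicator {..x} (X \<omega>) \<partial>M)"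
      unfolding set_lebesgue_integral_def x
      by (intro Bochner_Integration.integral_cong) (auto simp: indicator_def)
    then show ?case using orthant by simp
  next
    case empty
    then show ?case by (simp add: set_lebesgue_integral_def)
  next
    case (compl B)
    have [measurable]: "B \<in> sets borel" by (rule borel[OF compl(1)])
    have s: "X -` B \<inter> space M \<in> sets M" "X -` (UNIV - B) \<inter> space M \<in> sets M" by measurable
    have "space M = (X -` B \<inter> space M) \<union> (X -` (UNIV - B) \<inter> space M)" by auto
    then have "(LINT \<omega>:space M|M. f \<omega>) =
        (LINT \<omega>:(X -` B \<inter> space M) \<union> (X -` (UNIV - B) \<inter> space M)|M. f \<omega>)" by simp
    also have "\<dots> = (LINT \<omega>:X -` B \<inter> space M|M. f \<omega>) + (LINT \<omega>:X -` (UNIV - B) \<inter> space M|M. f \<omega>)"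
      by (rule set_integral_Un) (auto intro: int s)
    finally show ?case using compl.IH UN by simp
  next
    case (union B)
    have [measurable]: "B i \<in> sets borel" for i using union(2) borel by auto
    have s: "X -` B i \<inter> space M \<in> sets M" for i by measurable
    have "(LINT \<omega>:(\<Union>i. X -` B i \<inter> space M)|M. f \<omega>) = (\<Sum>i. LINT \<omega>:X -` B i \<inter> space M|M. f \<omega>)"
      using union(1)
      by (intro lebesgue_integral_countable_add s int sets.countable_UN) (auto simp: disjoint_family_on_def s)
    moreover have "X -` (\<Union>i. B i) \<inter> space M = (\<Union>i. X -` B i \<inter> space M)" by auto
    ultimately show ?case using union.IH by simp
  qed
qed

lemma (in finite_measure) square_integrable_if_powr:
  fixes f :: "'a \<Rightarrow> real"
  assumes f: "f \<in> borel_measurable M" and p: "2 \<le> p"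
    and int: "integrable M (\<lambda>x. \<bar>f x\<bar> powr p)"
  shows "integrable M (\<lambda>x. (f x)\<^sup>2)"
proof (rule Bochner_Integration.integrable_bound)
  show "integrable M (\<lambda>x. 1 + \<bar>f x\<bar> powr p)" using int by simp
  have "y\<^sup>2 \<le> 1 + \<bar>y\<bar> powr p" for y :: real
  proof (cases "\<bar>y\<bar> \<le> 1")
    case True
    then have "y\<^sup>2 \<le> 1" by (simp add: abs_square_le_1)
    then show ?thesis by (simp add: add_increasing2)
  next
    case False
    then have "\<bar>y\<bar> powr 2 \<le> \<bar>y\<bar> powr p" using p by (intro powr_mono) auto
    moreover have "\<bar>y\<bar> powr 2 = y\<^sup>2" using False by (simp add: powr_numeral)
    ultimately show ?thesis by simp
  qed
  then show "AE x in M. norm ((f x)\<^sup>2) \<le> norm (1 + \<bar>f x\<bar> powr p)"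
    by (intro AE_I2) (simp add: add_nonneg_nonneg)
qed (use f in measurable)

lemma continuous_on_outer: "continuous_on A (\<lambda>x. outer x x)"
  unfolding outer_def by (intro continuous_intros)

lemma borel_measurable_vec_nth [measurable (raw)]:
  fixes f :: "'q \<Rightarrow> real ^ 'd"
  assumes "f \<in> borel_measurable N"
  shows "(\<lambda>q. f q $ k) \<in> borel_measurable N"
  by (rule measurable_compose[OF assms borel_measurable_continuous_onI]) (intro continuous_intros)

subsection \<open>Least squares and the residual process\<close>

(* The rules about the dyad (1, 2) would not match after simp rewrites 1 to Suc 0. *)
declare One_nat_def [simp del]

context dyadic_sampling
begin

lemma borel_measurable_fst_snd [measurable]:
  "(fst :: real \<times> (real ^ 'd) \<Rightarrow> real) \<in> borel_measurable borel"
  "(snd :: real \<times> (real ^ 'd) \<Rightarrow> real ^ 'd) \<in> borel_measurable borel"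
  by (intro borel_measurable_continuous_onI continuous_intros)+

lemma XY_measurable:
  assumes "p \<in> dyad_indices"
  shows "(\<lambda>\<omega>. Y (fst p) (snd p) \<omega>) \<in> borel_measurable M"
    "(\<lambda>\<omega>. X (fst p) (snd p) \<omega>) \<in> borel_measurable M"
  using measurable_compose[OF measurable_Z[OF assms] borel_measurable_fst_snd(1)]
    measurable_compose[OF measurable_Z[OF assms] borel_measurable_fst_snd(2)]
  by (simp_all add: Z_def)

lemma X12_measurable [measurable]: "X 1 2 \<in> borel_measurable M"
  and Y12_measurable [measurable]: "Y 1 2 \<in> borel_measurable M"
  using XY_measurable[of "(1, 2)"] by simp_all

end

locale dyadic_regression = dyadic_sampling M S T U V \<tau> Y X "cbox a b"
  for M :: "'w measure" and S :: "'u measure" and T :: "'v measure"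
    and U :: "nat \<Rightarrow> 'w \<Rightarrow> 'u" and V :: "nat \<Rightarrow> nat \<Rightarrow> 'w \<Rightarrow> 'v"
    and \<tau> :: "'u \<Rightarrow> 'u \<Rightarrow> 'v \<Rightarrow> real \<times> (real ^ 'd)"
    and Y :: "nat \<Rightarrow> nat \<Rightarrow> 'w \<Rightarrow> real" and X :: "nat \<Rightarrow> nat \<Rightarrow> 'w \<Rightarrow> real ^ 'd"
    and a b :: "real ^ 'd" +
  assumes Y_square: "integrable M (\<lambda>\<omega>. (Y 1 2 \<omega>)\<^sup>2)"
    and Q_pos: "0 < smallest_eigenvalue (pop_Q M (X 1 2))"
begin

abbreviation Z12 :: "'w \<Rightarrow> real \<times> (real ^ 'd)" where "Z12 \<equiv> Z (1, 2)"

definition \<beta>0 :: "real ^ 'd" where "\<beta>0 = beta_star M (Y 1 2) (X 1 2)"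

definition resid :: "real \<times> (real ^ 'd) \<Rightarrow> real" where "resid z = fst z - snd z \<bullet> \<beta>0"

definition \<Delta> :: "real ^ 'd \<Rightarrow> real" where "\<Delta> x = Delta M (Y 1 2) (X 1 2) x"

lemma Z12_measurable [measurable]: "Z12 \<in> borel_measurable M"
  by (rule measurable_Z) simp

lemma fst_Z12: "fst (Z12 \<omega>) = Y 1 2 \<omega>" and snd_Z12: "snd (Z12 \<omega>) = X 1 2 \<omega>"
  by (simp_all add: Z_def)

lemma snd_Z_in_box: "p \<in> dyad_indices \<Longrightarrow> \<omega> \<in> space M \<Longrightarrow> snd (Z p \<omega>) \<in> cbox a b"
  by (cases p) (simp add: Z_def covariate_range)

text \<open>A probability space has a point, and the covariate there lies in the box.\<close>

lemma box_nonempty: "cbox a b \<noteq> {}"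
  using not_empty snd_Z_in_box[of "(1, 2)"] by fastforce

lemma box_bound: "\<exists>K>0. \<forall>x\<in>cbox a b. norm x \<le> K"
  using bounded_cbox[of a b] unfolding bounded_pos .

text \<open>One criterion for all functions fed to the weak law: covariate products, cross products
  and residuals grow at most linearly in the response while the covariate stays in the box.\<close>

lemma square_integrable_Z12:
  assumes h: "h \<in> borel_measurable borel"
    and le: "\<And>z. snd z \<in> cbox a b \<Longrightarrow> \<bar>h z\<bar> \<le> c * \<bar>fst z\<bar> + d"
  shows "integrable M (\<lambda>\<omega>. (h (Z12 \<omega>) :: real)\<^sup>2)"
proof (rule Bochner_Integration.integrable_bound)
  show "integrable M (\<lambda>\<omega>. 2 * c\<^sup>2 * (Y 1 2 \<omega>)\<^sup>2 + 2 * d\<^sup>2)" using Y_square by simp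
  show "(\<lambda>\<omega>. (h (Z12 \<omega>))\<^sup>2) \<in> borel_measurable M"
    using measurable_compose[OF Z12_measurable h] by measurable
  show "AE \<omega> in M. norm ((h (Z12 \<omega>))\<^sup>2) \<le> norm (2 * c\<^sup>2 * (Y 1 2 \<omega>)\<^sup>2 + 2 * d\<^sup>2)"
  proof (rule AE_I2)
    fix \<omega> assume "\<omega> \<in> space M"
    then have "\<bar>h (Z12 \<omega>)\<bar> \<le> c * \<bar>Y 1 2 \<omega>\<bar> + d"
      using le[of "Z12 \<omega>"] snd_Z_in_box[of "(1, 2)" \<omega>] by (simp add: fst_Z12)
    then have "\<bar>h (Z12 \<omega>)\<bar>\<^sup>2 \<le> (c * \<bar>Y 1 2 \<omega>\<bar> + d)\<^sup>2" by (rule power_mono) simp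
    also have "\<dots> \<le> 2 * (c * \<bar>Y 1 2 \<omega>\<bar>)\<^sup>2 + 2 * d\<^sup>2"
      using sum_squares_bound[of "c * \<bar>Y 1 2 \<omega>\<bar>" d] unfolding power2_sum by linarith
    finally show "norm ((h (Z12 \<omega>))\<^sup>2) \<le> norm (2 * c\<^sup>2 * (Y 1 2 \<omega>)\<^sup>2 + 2 * d\<^sup>2)"
      by (simp add: power_mult_distrib)
  qed
qed

lemma integrable_Z12:
  assumes "h \<in> borel_measurable borel"
    and "\<And>z. snd z \<in> cbox a b \<Longrightarrow> \<bar>h z\<bar> \<le> c * \<bar>fst z\<bar> + d"
  shows "integrable M (\<lambda>\<omega>. h (Z12 \<omega>) :: real)"
  by (rule square_integrable_imp_integrable[OF measurable_compose[OF Z12_measurable assms(1)]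
        square_integrable_Z12[OF assms]])

lemma resid_measurable [measurable]: "resid \<in> borel_measurable borel"
  unfolding resid_def by measurable

lemma resid_le:
  assumes "\<And>x. x \<in> cbox a b \<Longrightarrow> norm x \<le> K" "snd z \<in> cbox a b"
  shows "\<bar>resid z\<bar> \<le> 1 * \<bar>fst z\<bar> + K * norm \<beta>0"
proof -
  have "\<bar>snd z \<bullet> \<beta>0\<bar> \<le> norm (snd z) * norm \<beta>0" by (rule Cauchy_Schwarz_ineq2)
  also have "\<dots> \<le> K * norm \<beta>0" using assms by (intro mult_right_mono) auto
  finally show ?thesis by (simp add: resid_def)
qed

lemma resid_square_integrable: "integrable M (\<lambda>\<omega>. (resid (Z12 \<omega>))\<^sup>2)"
  and resid_integrable: "integrable M (\<lambda>\<omega>. resid (Z12 \<omega>))"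
proof -
  obtain K where K0: "K > 0 \<and> (\<forall>x\<in>cbox a b. norm x \<le> K)" using box_bound by (rule exE)
  note K = K0[THEN conjunct2, rule_format]
  show "integrable M (\<lambda>\<omega>. (resid (Z12 \<omega>))\<^sup>2)"
    by (rule square_integrable_Z12[OF resid_measurable resid_le[OF K]])
  show "integrable M (\<lambda>\<omega>. resid (Z12 \<omega>))"
    by (rule integrable_Z12[OF resid_measurable resid_le[OF K]])
qed

lemma Delta_eq: "\<Delta> x = expectation (\<lambda>\<omega>. resid (Z12 \<omega>) * indicator {..x} (snd (Z12 \<omega>)))"
  by (simp add: \<Delta>_def Delta_def Z_def resid_def \<beta>0_def)

text \<open>Reading off entries commutes with the matrix-valued integral because the integrand is
  bounded on the compact box; this gives access to the scalar weak law.\<close>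

lemma pop_Q_nth:
  "pop_Q M (X 1 2) $ k $ l = expectation (\<lambda>\<omega>. snd (Z12 \<omega>) $ k * snd (Z12 \<omega>) $ l)"
proof -
  have "compact ((\<lambda>x. outer x x) ` cbox a b)"
    by (intro compact_continuous_image continuous_on_outer compact_cbox)
  then have "\<exists>B. \<forall>x\<in>cbox a b. norm (outer x x) \<le> B"
    by (auto dest!: compact_imp_bounded simp: bounded_iff)
  then obtain B where B: "\<forall>x\<in>cbox a b. norm (outer x x) \<le> B" by (rule exE)
  have "(\<lambda>\<omega>. outer (X 1 2 \<omega>) (X 1 2 \<omega>)) \<in> borel_measurable M"
    by (rule measurable_compose[OF X12_measurable borel_measurable_continuous_onI[OF continuous_on_outer]])
  then have i: "integrable M (\<lambda>\<omega>. outer (X 1 2 \<omega>) (X 1 2 \<omega>))"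
    using snd_Z_in_box[of "(1, 2)"]
    by (intro integrable_const_bound[where B = B]) (auto simp: snd_Z12 intro!: B[rule_format])
  have "bounded_linear (\<lambda>A :: real ^ 'd ^ 'd. A $ k $ l)"
    by (rule bounded_linear_compose[OF bounded_linear_vec_nth bounded_linear_vec_nth])
  from integral_bounded_linear[OF this i] show ?thesis
    by (simp add: pop_Q_def outer_def snd_Z12)
qed

lemma cross_moment_nth:
  "(\<integral>\<omega>. Y 1 2 \<omega> *\<^sub>R X 1 2 \<omega> \<partial>M) $ k = expectation (\<lambda>\<omega>. fst (Z12 \<omega>) * snd (Z12 \<omega>) $ k)"
proof -
  obtain K where K0: "K > 0 \<and> (\<forall>x\<in>cbox a b. norm x \<le> K)" using box_bound by (rule exE)
  note K = K0[THEN conjunct1] K0[THEN conjunct2, rule_format]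
  have iY: "integrable M (Y 1 2)"
    by (rule square_integrable_imp_integrable[OF Y12_measurable Y_square])
  have "integrable M (\<lambda>\<omega>. Y 1 2 \<omega> *\<^sub>R X 1 2 \<omega>)"
  proof (rule Bochner_Integration.integrable_bound)
    show "integrable M (\<lambda>\<omega>. K * Y 1 2 \<omega>)" using iY by simp
    show "AE \<omega> in M. norm (Y 1 2 \<omega> *\<^sub>R X 1 2 \<omega>) \<le> norm (K * Y 1 2 \<omega>)"
    proof (rule AE_I2)
      fix \<omega> assume "\<omega> \<in> space M"
      then have "norm (X 1 2 \<omega>) \<le> K" using snd_Z_in_box[of "(1, 2)" \<omega>] K(2) by (simp add: snd_Z12)
      then have "\<bar>Y 1 2 \<omega>\<bar> * norm (X 1 2 \<omega>) \<le> \<bar>Y 1 2 \<omega>\<bar> * K" by (intro mult_left_mono) auto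
      then show "norm (Y 1 2 \<omega> *\<^sub>R X 1 2 \<omega>) \<le> norm (K * Y 1 2 \<omega>)" using K(1) by (simp add: abs_mult mult.commute)
    qed
  qed measurable
  from integral_bounded_linear[OF bounded_linear_vec_nth this, of k] show ?thesis
    by (simp add: snd_Z12 fst_Z12)
qed

lemma sample_Q_nth:
  "sample_Q n (\<lambda>i j. X i j \<omega>) $ k $ l = zmean n (\<lambda>z. snd z $ k * snd z $ l) \<omega>"
  by (simp add: sample_Q_def zmean_def dyad_mean_def outer_def case_prod_beta)

lemma sample_cross_nth:
  "dyad_mean n (\<lambda>i j. Y i j \<omega> *\<^sub>R X i j \<omega>) $ k = zmean n (\<lambda>z. fst z * snd z $ k) \<omega>"
  by (simp add: zmean_def dyad_mean_def case_prod_beta)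

lemma pop_Q_nonsingular:
  assumes "pop_Q M (X 1 2) *v v = 0"
  shows "v = 0"
proof (rule nonsingular_if_smallest_eigenvalue_pos[OF _ Q_pos assms])
  show "transpose (pop_Q M (X 1 2)) = pop_Q M (X 1 2)"
    by (simp add: vec_eq_iff transpose_def pop_Q_nth mult.commute)
qed

text \<open>The entries of the Gram matrix and of the cross moment are finitely many dyadic means,
  and the conditional premise of \<open>least_squares_stable\<close> is precisely
  \<open>is_ols\<close>.\<close>

lemma ols_consistent:
  assumes ols: "\<And>n \<omega>. \<omega> \<in> space M \<Longrightarrow> is_ols n (\<lambda>i j. Y i j \<omega>) (\<lambda>i j. X i j \<omega>) (\<beta> n \<omega>)"
    and e: "e > 0"
  shows "whp (\<lambda>n \<omega>. norm (\<beta> n \<omega> - \<beta>0) \<le> e)"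
proof -
  obtain K where K0: "K > 0 \<and> (\<forall>x\<in>cbox a b. norm x \<le> K)" using box_bound by (rule exE)
  note K = K0[THEN conjunct1] K0[THEN conjunct2, rule_format]
  have Kc: "\<bar>x $ k\<bar> \<le> K" if "x \<in> cbox a b" for x k
    using K(2)[OF that] component_le_norm_cart[of x k] by linarith
  let ?m = "\<integral>\<omega>. Y 1 2 \<omega> *\<^sub>R X 1 2 \<omega> \<partial>M"
  obtain \<eta> where \<eta>: "\<eta> > 0" and stable: "\<And>Q' m' \<beta>'. (\<forall>k l. \<bar>Q' $ k $ l - pop_Q M (X 1 2) $ k $ l\<bar> \<le> \<eta>) \<Longrightarrow>
     (\<forall>k. \<bar>m' $ k - ?m $ k\<bar> \<le> \<eta>) \<Longrightarrow>
     (invertible Q' \<longrightarrow> \<beta>' = matrix_inv Q' *v m') \<Longrightarrow> norm (\<beta>' - matrix_inv (pop_Q M (X 1 2)) *v ?m) \<le> e"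
    using least_squares_stable[of "pop_Q M (X 1 2)" e ?m, OF pop_Q_nonsingular e] by auto
  have 1: "whp (\<lambda>n \<omega>. \<bar>zmean n (\<lambda>z. snd z $ k * snd z $ l) \<omega> - pop_Q M (X 1 2) $ k $ l\<bar> \<le> \<eta>)" for k l
    unfolding pop_Q_nth
  proof (rule weak_law[OF _ square_integrable_Z12 \<eta>])
    show "(\<lambda>z :: real \<times> (real ^ 'd). snd z $ k * snd z $ l) \<in> borel_measurable borel"
      by measurable
    then show "(\<lambda>z :: real \<times> (real ^ 'd). snd z $ k * snd z $ l) \<in> borel_measurable borel" .
    fix z :: "real \<times> (real ^ 'd)" assume "snd z \<in> cbox a b"
    then show "\<bar>snd z $ k * snd z $ l\<bar> \<le> 0 * \<bar>fst z\<bar> + K * K"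
      using Kc K(1) by (simp add: abs_mult mult_mono)
  qed
  have 2: "whp (\<lambda>n \<omega>. \<bar>zmean n (\<lambda>z. fst z * snd z $ k) \<omega> - ?m $ k\<bar> \<le> \<eta>)" for k
    unfolding cross_moment_nth
  proof (rule weak_law[OF _ square_integrable_Z12 \<eta>])
    show "(\<lambda>z :: real \<times> (real ^ 'd). fst z * snd z $ k) \<in> borel_measurable borel"
      by measurable
    then show "(\<lambda>z :: real \<times> (real ^ 'd). fst z * snd z $ k) \<in> borel_measurable borel" .
    fix z :: "real \<times> (real ^ 'd)" assume "snd z \<in> cbox a b"
    then have "\<bar>fst z\<bar> * \<bar>snd z $ k\<bar> \<le> \<bar>fst z\<bar> * K" using Kc by (intro mult_left_mono) auto
    then show "\<bar>fst z * snd z $ k\<bar> \<le> K * \<bar>fst z\<bar> + 0" by (simp add: abs_mult mult.commute)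
  qed
  have "whp (\<lambda>n \<omega>. (\<forall>k\<in>UNIV. \<forall>l\<in>UNIV. \<bar>zmean n (\<lambda>z. snd z $ k * snd z $ l) \<omega> - pop_Q M (X 1 2) $ k $ l\<bar> \<le> \<eta>) \<and>
      (\<forall>k\<in>UNIV. \<bar>zmean n (\<lambda>z. fst z * snd z $ k) \<omega> - ?m $ k\<bar> \<le> \<eta>))"
    by (intro whp_conj whp_ball_finite 1 2) simp_all
  then show ?thesis
  proof (rule whp_mono)
    fix n \<omega>
    assume \<omega>: "\<omega> \<in> space M" and
      P: "(\<forall>k\<in>UNIV. \<forall>l\<in>UNIV. \<bar>zmean n (\<lambda>z. snd z $ k * snd z $ l) \<omega> - pop_Q M (X 1 2) $ k $ l\<bar> \<le> \<eta>) \<and>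
      (\<forall>k\<in>UNIV. \<bar>zmean n (\<lambda>z. fst z * snd z $ k) \<omega> - ?m $ k\<bar> \<le> \<eta>)"
    show "norm (\<beta> n \<omega> - \<beta>0) \<le> e"
      unfolding \<beta>0_def beta_star_def
    proof (rule stable)
      show "\<forall>k l. \<bar>sample_Q n (\<lambda>i j. X i j \<omega>) $ k $ l - pop_Q M (X 1 2) $ k $ l\<bar> \<le> \<eta>"
        using P by (simp add: sample_Q_nth)
      show "\<forall>k. \<bar>dyad_mean n (\<lambda>i j. Y i j \<omega> *\<^sub>R X i j \<omega>) $ k - ?m $ k\<bar> \<le> \<eta>"
        using P by (simp add: sample_cross_nth)
      show "invertible (sample_Q n (\<lambda>i j. X i j \<omega>)) \<longrightarrow> \<beta> n \<omega> =
          matrix_inv (sample_Q n (\<lambda>i j. X i j \<omega>)) *v dyad_mean n (\<lambda>i j. Y i j \<omega> *\<^sub>R X i j \<omega>)"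
        using ols[OF \<omega>, of n] unfolding is_ols_def .
    qed
  qed
qed

abbreviation RH :: "nat \<Rightarrow> 'w \<Rightarrow> real ^ 'd \<Rightarrow> real ^ 'd \<Rightarrow> real" where
  "RH n \<omega> v x \<equiv> R_hat n (\<lambda>i j. Y i j \<omega>) (\<lambda>i j. X i j \<omega>) v x"

lemma R_hat_eq_zmean: "RH n \<omega> v x = zmean n (\<lambda>z. (fst z - snd z \<bullet> v) * indicator {..x} (snd z)) \<omega>"
  by (simp add: R_hat_def zmean_def)

text \<open>The residual is affine in the coefficients, so the estimation error splits off as a term
  linear in \<open>v - \<beta>0\<close>, and the first term is free of \<open>v\<close>.\<close>

lemma R_hat_decomp:
  "RH n \<omega> v x = zmean n (\<lambda>z. resid z * indicator {..x} (snd z)) \<omega> -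
    zmean n (\<lambda>z. (snd z \<bullet> (v - \<beta>0)) * indicator {..x} (snd z)) \<omega>"
  unfolding R_hat_eq_zmean zmean_diff[symmetric]
  by (intro arg_cong[where f = "\<lambda>f. zmean n f \<omega>"]) (simp add: fun_eq_iff resid_def algebra_simps inner_diff_right)

lemma R_hat_uniformly_consistent:
  assumes ols: "\<And>n \<omega>. \<omega> \<in> space M \<Longrightarrow> is_ols n (\<lambda>i j. Y i j \<omega>) (\<lambda>i j. X i j \<omega>) (\<beta> n \<omega>)"
    and e: "e > 0"
  shows "whp (\<lambda>n \<omega>. \<forall>x\<in>cbox a b. \<bar>RH n \<omega> (\<beta> n \<omega>) x - \<Delta> x\<bar> \<le> e)"
proof -
  obtain K where K0: "K > 0 \<and> (\<forall>x\<in>cbox a b. norm x \<le> K)" using box_bound by (rule exE)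
  note K = K0[THEN conjunct1] K0[THEN conjunct2, rule_format]
  \<comment> \<open>The covariate law weighted by the absolute residual; its total mass is the mean
    absolute residual.\<close>
  let ?N = "distr (density M (\<lambda>\<omega>. ennreal \<bar>resid (Z12 \<omega>)\<bar>)) borel (\<lambda>\<omega>. snd (Z12 \<omega>))"
  have "finite_measure (density M (\<lambda>\<omega>. ennreal \<bar>resid (Z12 \<omega>)\<bar>))"
  proof
    have "emeasure (density M (\<lambda>\<omega>. ennreal \<bar>resid (Z12 \<omega>)\<bar>)) (space M) = (\<integral>\<^sup>+\<omega>. ennreal \<bar>resid (Z12 \<omega>)\<bar> \<partial>M)"
      by (subst emeasure_density) (auto intro!: nn_integral_cong)
    also have "\<dots> = ennreal (expectation (\<lambda>\<omega>. \<bar>resid (Z12 \<omega>)\<bar>))"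
      using resid_integrable by (intro nn_integral_eq_integral) auto
    finally show "emeasure (density M (\<lambda>\<omega>. ennreal \<bar>resid (Z12 \<omega>)\<bar>))
        (space (density M (\<lambda>\<omega>. ennreal \<bar>resid (Z12 \<omega>)\<bar>))) \<noteq> \<infinity>" by simp
  qed
  then have "finite_measure ?N" by (rule finite_measure.finite_measure_distr) simp
  then have br: "finitely_bracketed ?N (atMost ` cbox a b)" by (rule finitely_bracketed_orthants) simp
  \<comment> \<open>By Cauchy-Schwarz a coefficient error of \<open>e / (2 * K)\<close> shifts each
    residual by at most \<open>e / 2\<close>, whatever the orthant.\<close>
  have "e / 2 > 0" "e / (2 * K) > 0" using e K(1) by simp_all
  then have "whp (\<lambda>n \<omega>. (\<forall>A\<in>atMost ` cbox a b. \<bar>zmean n (\<lambda>z. resid z * indicator A (snd z)) \<omega> -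
      expectation (\<lambda>\<omega>. resid (Z12 \<omega>) * indicator A (snd (Z12 \<omega>)))\<bar> \<le> e / 2) \<and> norm (\<beta> n \<omega> - \<beta>0) \<le> e / (2 * K))"
    by (intro whp_conj uniform_weak_law resid_measurable resid_square_integrable br ols_consistent[OF ols]) auto
  then show ?thesis
  proof (rule whp_mono, intro ballI)
    fix n \<omega> x
    assume \<omega>: "\<omega> \<in> space M" and x: "x \<in> cbox a b"
      and P: "(\<forall>A\<in>atMost ` cbox a b. \<bar>zmean n (\<lambda>z. resid z * indicator A (snd z)) \<omega> -
      expectation (\<lambda>\<omega>. resid (Z12 \<omega>) * indicator A (snd (Z12 \<omega>)))\<bar> \<le> e / 2) \<and> norm (\<beta> n \<omega> - \<beta>0) \<le> e / (2 * K)"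
    have 1: "\<bar>zmean n (\<lambda>z. resid z * indicator {..x} (snd z)) \<omega> - \<Delta> x\<bar> \<le> e / 2"
      using P x unfolding Delta_eq by blast
    have 2: "\<bar>zmean n (\<lambda>z. (snd z \<bullet> (\<beta> n \<omega> - \<beta>0)) * indicator {..x} (snd z)) \<omega>\<bar> \<le> e / 2"
    proof (rule zmean_abs_le_const)
      fix p assume "p \<in> dyads n"
      then have "norm (snd (Z p \<omega>)) \<le> K"
        using \<omega> dyads_subset_dyad_indices[of n] by (auto intro!: K(2) snd_Z_in_box)
      then have "norm (snd (Z p \<omega>)) * norm (\<beta> n \<omega> - \<beta>0) \<le> K * (e / (2 * K))"
        using P K(1) by (intro mult_mono) auto
      then have "\<bar>snd (Z p \<omega>) \<bullet> (\<beta> n \<omega> - \<beta>0)\<bar> \<le> e / 2"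
        using Cauchy_Schwarz_ineq2[of "snd (Z p \<omega>)" "\<beta> n \<omega> - \<beta>0"] K(1) by simp
      then show "\<bar>(snd (Z p \<omega>) \<bullet> (\<beta> n \<omega> - \<beta>0)) * indicator {..x} (snd (Z p \<omega>))\<bar> \<le> e / 2"
        using e by (auto simp: indicator_def)
    qed (use e in simp)
    show "\<bar>RH n \<omega> (\<beta> n \<omega>) x - \<Delta> x\<bar> \<le> e"
      using 1 2 unfolding R_hat_decomp by linarith
  qed
qed

section \<open>Boundedness of \<open>\<Delta>\<close> and positivity of its supremum\<close>

lemma Delta_bounded: "\<bar>\<Delta> x\<bar> \<le> expectation (\<lambda>\<omega>. \<bar>resid (Z12 \<omega>)\<bar>)"
proof -
  have m: "(\<lambda>\<omega>. indicator {..x} (snd (Z12 \<omega>)) :: real) \<in> borel_measurable M" by measurable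
  have "\<bar>\<Delta> x\<bar> \<le> expectation (\<lambda>\<omega>. \<bar>resid (Z12 \<omega>) * indicator {..x} (snd (Z12 \<omega>))\<bar>)"
    unfolding Delta_eq by (rule integral_abs_bound)
  also have "\<dots> \<le> expectation (\<lambda>\<omega>. \<bar>resid (Z12 \<omega>)\<bar>)"
  proof (rule integral_mono)
    show "integrable M (\<lambda>\<omega>. \<bar>resid (Z12 \<omega>) * indicator {..x} (snd (Z12 \<omega>))\<bar>)"
      using m by (intro integrable_abs Bochner_Integration.integrable_bound[OF resid_integrable])
        (auto simp: indicator_def)
    show "integrable M (\<lambda>\<omega>. \<bar>resid (Z12 \<omega>)\<bar>)" using resid_integrable by simp
  qed (auto simp: indicator_def)
  finally show ?thesis .
qed

lemma bdd_above_Delta: "bdd_above ((\<lambda>x. \<bar>\<Delta> x\<bar>) ` A)"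
  using Delta_bounded by (intro bdd_aboveI2)

text \<open>If \<open>\<Delta>\<close> vanished on the rectangle, the residual would integrate to zero over the orthants,
  a generating pi-system, hence over every event of the sigma-algebra of \<open>X 1 2\<close>.\<close>

lemma Delta_nonzero:
  assumes "\<not> linear_cond_mean M (Y 1 2) (X 1 2)"
  shows "\<exists>x\<in>cbox a b. \<Delta> x \<noteq> 0"
proof (rule ccontr)
  assume "\<not> (\<exists>x\<in>cbox a b. \<Delta> x \<noteq> 0)"
  then have zero: "\<Delta> x = 0" if "x \<in> cbox a b" for x using that by blast
  have box: "a \<le> X 1 2 \<omega>" "X 1 2 \<omega> \<le> b" if "\<omega> \<in> space M" for \<omega>
    using snd_Z_in_box[of "(1, 2)" \<omega>] that by (simp_all add: snd_Z12 interval_cbox_cart[symmetric])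
  have ab: "a \<le> b" using box_nonempty by (simp add: interval_cbox_cart[symmetric])
  \<comment> \<open>Apices outside the box: an orthant whose apex dominates \<open>a\<close> meets
    the range of the covariate as the orthant at \<open>inf x b\<close> does, and any other orthant
    misses it.\<close>
  have orthant: "(\<integral>\<omega>. resid (Z12 \<omega>) * indicator {..x} (X 1 2 \<omega>) \<partial>M) = 0" for x
  proof (cases "a \<le> x")
    case True
    have "(\<integral>\<omega>. resid (Z12 \<omega>) * indicator {..x} (X 1 2 \<omega>) \<partial>M) = \<Delta> (inf x b)"
      unfolding Delta_eq snd_Z12
      by (intro Bochner_Integration.integral_cong) (auto simp: indicator_def box)
    also have "\<dots> = 0" using True ab by (intro zero) (simp add: interval_cbox_cart[symmetric])
    finally show ?thesis .
  next
    case False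
    then have "\<not> X 1 2 \<omega> \<le> x" if "\<omega> \<in> space M" for \<omega> using box(1)[OF that] by (meson order_trans)
    then have "(\<integral>\<omega>. resid (Z12 \<omega>) * indicator {..x} (X 1 2 \<omega>) \<partial>M) = (\<integral>\<omega>. 0 \<partial>M)"
      by (intro Bochner_Integration.integral_cong) auto
    then show ?thesis by simp
  qed
  have total: "(\<integral>\<omega>. resid (Z12 \<omega>) \<partial>M) = 0"
  proof -
    have "(\<integral>\<omega>. resid (Z12 \<omega>) \<partial>M) = (\<integral>\<omega>. resid (Z12 \<omega>) * indicator {..b} (X 1 2 \<omega>) \<partial>M)"
      by (intro Bochner_Integration.integral_cong) (simp_all add: box)
    then show ?thesis by (simp add: orthant)
  qed
  let ?F = "vimage_algebra (space M) (X 1 2) borel"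
  have sF: "sets ?F = {X 1 2 -` A \<inter> space M | A. A \<in> sets borel}"
    by (rule sets_vimage_algebra2) simp
  have sub: "subalgebra M ?F"
    unfolding subalgebra_def sF using measurable_sets[OF X12_measurable] by auto
  interpret F: finite_measure_subalgebra M ?F
    by unfold_locales (rule sub)
  interpret F: sigma_finite_subalgebra M ?F
    by (rule finite_measure_subalgebra_is_sigma_finite) (rule F.finite_measure_subalgebra_axioms)
  have iY: "integrable M (Y 1 2)"
    by (rule square_integrable_imp_integrable[OF Y12_measurable Y_square])
  have ir: "integrable M (\<lambda>\<omega>. resid (Z12 \<omega>))" by (rule resid_integrable)
  have eq: "X 1 2 \<omega> \<bullet> \<beta>0 = Y 1 2 \<omega> - resid (Z12 \<omega>)" for \<omega> by (simp add: resid_def fst_Z12 snd_Z12)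
  have iX: "integrable M (\<lambda>\<omega>. X 1 2 \<omega> \<bullet> \<beta>0)" unfolding eq using iY ir by simp
  \<comment> \<open>The linear predictor is measurable with respect to the covariate and has the
    same integrals as the response over its events, which characterises the conditional
    expectation.\<close>
  have "AE \<omega> in M. real_cond_exp M ?F (Y 1 2) \<omega> = X 1 2 \<omega> \<bullet> \<beta>0"
  proof (rule F.real_cond_exp_charact[OF _ iY iX])
    fix A assume "A \<in> sets ?F"
    then obtain B where B: "B \<in> sets borel" "A = X 1 2 -` B \<inter> space M" unfolding sF by auto
    have A: "A \<in> sets M" unfolding B(2) by (rule measurable_sets[OF X12_measurable B(1)])
    have "(LINT \<omega>:A|M. resid (Z12 \<omega>)) = 0"
      unfolding B(2) by (rule borel_integral_zero_if_orthants[OF ir X12_measurable total orthant B(1)])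
    moreover have "(LINT \<omega>:A|M. X 1 2 \<omega> \<bullet> \<beta>0) = (LINT \<omega>:A|M. Y 1 2 \<omega>) - (LINT \<omega>:A|M. resid (Z12 \<omega>))"
      unfolding eq using A iY ir unfolding set_lebesgue_integral_def
      by (simp add: right_diff_distrib integrable_mult_indicator[where 'b = real, simplified])
    ultimately show "(LINT \<omega>:A|M. Y 1 2 \<omega>) = (LINT \<omega>:A|M. X 1 2 \<omega> \<bullet> \<beta>0)" by simp
  next
    have "X 1 2 \<in> measurable ?F borel" by (rule measurable_vimage_algebra1) simp
    then show "(\<lambda>\<omega>. X 1 2 \<omega> \<bullet> \<beta>0) \<in> borel_measurable ?F" by measurable
  qed
  then have "linear_cond_mean M (Y 1 2) (X 1 2)" unfolding linear_cond_mean_def \<beta>0_def .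
  with assms show False by contradiction
qed

lemma SUP_Delta_pos:
  assumes "\<not> linear_cond_mean M (Y 1 2) (X 1 2)"
  shows "0 < (SUP x\<in>cbox a b. \<bar>\<Delta> x\<bar>)"
proof -
  obtain x where "x \<in> cbox a b" "\<Delta> x \<noteq> 0" using Delta_nonzero[OF assms] by (rule bexE)
  then show ?thesis using cSUP_upper[OF _ bdd_above_Delta, of x "cbox a b"] by linarith
qed

section \<open>Measurability of the statistics\<close>

text \<open>The apex varies along with the point, so this is no preimage of a fixed orthant;
  finitely many coordinate comparisons decide membership.\<close>

lemma orthant_indicator_measurable:
  fixes f g :: "'q \<Rightarrow> real ^ 'd"
  assumes [measurable]: "f \<in> borel_measurable N" "g \<in> borel_measurable N"
  shows "(\<lambda>q. indicator {..g q} (f q) :: real) \<in> borel_measurable N"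
proof -
  have "(\<lambda>q. indicator {..g q} (f q) :: real) = (\<lambda>q. if \<forall>k\<in>UNIV. f q $ k \<le> g q $ k then 1 else 0)"
    by (auto simp: fun_eq_iff indicator_def less_eq_vec_def)
  also have "\<dots> \<in> borel_measurable N" by measurable
  finally show ?thesis .
qed

text \<open>Joint measurability yields both kinds of sections and, by Fubini, measurability of the
  integrated square.\<close>

lemma R_hat_measurable_pair:
  assumes \<beta>: "\<beta> \<in> borel_measurable M"
  shows "(\<lambda>q. RH n (fst q) (\<beta> (fst q)) (snd q)) \<in> borel_measurable (M \<Otimes>\<^sub>M borel)"
proof -
  note [measurable] = measurable_compose[OF measurable_fst \<beta>]
  have "(\<lambda>q. (Y (fst p) (snd p) (fst q) - X (fst p) (snd p) (fst q) \<bullet> \<beta> (fst q)) *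
      indicator {..snd q} (X (fst p) (snd p) (fst q))) \<in> borel_measurable (M \<Otimes>\<^sub>M borel)"
    if "p \<in> dyads n" for p
  proof -
    have p: "p \<in> dyad_indices" using that dyads_subset_dyad_indices by blast
    note [measurable] = measurable_compose[OF measurable_fst XY_measurable(1)[OF p]]
      measurable_compose[OF measurable_fst XY_measurable(2)[OF p]]
    have [measurable]: "(\<lambda>q. indicator {..snd q} (X (fst p) (snd p) (fst q)) :: real) \<in> borel_measurable (M \<Otimes>\<^sub>M borel)"
      by (rule orthant_indicator_measurable) measurable
    show ?thesis by measurable
  qed
  then show ?thesis
    unfolding R_hat_def dyad_mean_def case_prod_beta real_scaleR_def
    by (intro borel_measurable_times[OF borel_measurable_const borel_measurable_sum])
qed

lemma R_hat_measurable:
  assumes "\<beta> \<in> borel_measurable M"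
  shows "(\<lambda>\<omega>. RH n \<omega> (\<beta> \<omega>) x) \<in> borel_measurable M"
    and "\<omega> \<in> space M \<Longrightarrow> (\<lambda>x. RH n \<omega> (\<beta> \<omega>) x) \<in> borel_measurable borel"
proof -
  have "(\<lambda>\<omega>. (\<omega>, x)) \<in> measurable M (M \<Otimes>\<^sub>M borel)" by measurable
  from measurable_compose[OF this R_hat_measurable_pair[OF assms, of n]]
  show "(\<lambda>\<omega>. RH n \<omega> (\<beta> \<omega>) x) \<in> borel_measurable M" by simp
  assume "\<omega> \<in> space M"
  then have "(\<lambda>x. (\<omega>, x)) \<in> measurable borel (M \<Otimes>\<^sub>M borel)" by measurable
  from measurable_compose[OF this R_hat_measurable_pair[OF assms, of n]]
  show "(\<lambda>x. RH n \<omega> (\<beta> \<omega>) x) \<in> borel_measurable borel" by simp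
qed

text \<open>For fixed \<open>\<omega>\<close>, the value of \<open>R_hat\<close> at \<open>x\<close> depends only on which of the finitely many
  observed covariates lie below \<open>x\<close>, so the supremum over a suitable countable set is the same.\<close>

lemma SUP_R_hat_measurable:
  assumes \<beta>: "\<beta> \<in> borel_measurable M"
  shows "(\<lambda>\<omega>. SUP x\<in>cbox a b. \<bar>RH n \<omega> (\<beta> \<omega>) x\<bar>) \<in> borel_measurable M"
proof -
  obtain D where D: "countable D" "D \<subseteq> cbox a b"
    "\<And>t P. t \<in> cbox a b \<Longrightarrow> finite P \<Longrightarrow> P \<subseteq> cbox a b \<Longrightarrow> \<exists>t'\<in>D. \<forall>p\<in>P. p \<le> t' \<longleftrightarrow> p \<le> t"
    using countable_orthant_witnesses[of a b] by blast
  have img: "(\<lambda>x. \<bar>RH n \<omega> (\<beta> \<omega>) x\<bar>) ` cbox a b = (\<lambda>x. \<bar>RH n \<omega> (\<beta> \<omega>) x\<bar>) ` D"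
    if \<omega>: "\<omega> \<in> space M" for \<omega>
  proof (rule equalityI[OF _ image_mono[OF D(2)]], rule subsetI)
    fix r assume "r \<in> (\<lambda>x. \<bar>RH n \<omega> (\<beta> \<omega>) x\<bar>) ` cbox a b"
    then obtain t where t: "r = \<bar>RH n \<omega> (\<beta> \<omega>) t\<bar>" "t \<in> cbox a b" by (rule imageE)
    let ?P = "(\<lambda>p. snd (Z p \<omega>)) ` dyads n"
    have "?P \<subseteq> cbox a b" using \<omega> dyads_subset_dyad_indices[of n] by (auto intro!: snd_Z_in_box)
    from D(3)[OF t(2) _ this] obtain t' where t': "t' \<in> D" "\<forall>p\<in>?P. p \<le> t' \<longleftrightarrow> p \<le> t"
      using finite_dyads[of n] by blast
    have "RH n \<omega> (\<beta> \<omega>) t = RH n \<omega> (\<beta> \<omega>) t'"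
      unfolding R_hat_eq_zmean zmean_eq using t'(2)
      by (intro arg_cong2[where f = "(/)"] sum.cong refl) (simp add: indicator_def)
    then show "r \<in> (\<lambda>x. \<bar>RH n \<omega> (\<beta> \<omega>) x\<bar>) ` D" using t(1) t'(1) by (intro image_eqI[of _ _ t']) simp_all
  qed
  have "(\<lambda>\<omega>. SUP x\<in>D. \<bar>RH n \<omega> (\<beta> \<omega>) x\<bar>) \<in> borel_measurable M"
  proof (rule borel_measurable_cSUP[OF D(1)])
    show "(\<lambda>\<omega>. \<bar>RH n \<omega> (\<beta> \<omega>) x\<bar>) \<in> borel_measurable M" for x
      using R_hat_measurable(1)[OF \<beta>, of n x] by measurable
    fix \<omega> assume "\<omega> \<in> space M"
    show "bdd_above ((\<lambda>x. \<bar>RH n \<omega> (\<beta> \<omega>) x\<bar>) ` D)"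
    proof (rule bdd_aboveI2)
      show "\<bar>RH n \<omega> (\<beta> \<omega>) x\<bar> \<le> zmean n (\<lambda>z. \<bar>fst z - snd z \<bullet> \<beta> \<omega>\<bar>) \<omega>" for x
        unfolding R_hat_eq_zmean by (rule zmean_abs_le) (simp add: indicator_def)
    qed
  qed
  then show ?thesis
    using img by (subst measurable_cong) simp_all
qed

lemma Delta_measurable: "\<Delta> \<in> borel_measurable borel"
proof -
  have "(\<lambda>q. indicator {..fst q} (snd (Z12 (snd q))) :: real) \<in> borel_measurable (borel \<Otimes>\<^sub>M M)"
    by (rule orthant_indicator_measurable) measurable
  then have "(\<lambda>q. resid (Z12 (snd q)) * indicator {..fst q} (snd (Z12 (snd q)))) \<in> borel_measurable (borel \<Otimes>\<^sub>M M)"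
    by measurable
  then have "(\<lambda>x. \<integral>\<omega>. resid (Z12 \<omega>) * indicator {..x} (snd (Z12 \<omega>)) \<partial>M) \<in> borel_measurable borel"
    by (intro borel_measurable_lebesgue_integral) (simp add: case_prod_beta)
  then show ?thesis by (simp add: Delta_eq[abs_def])
qed

section \<open>Integrals against a finite measure on the rectangle\<close>

context
  fixes \<nu> :: "(real ^ 'd) measure"
  assumes \<nu>: "finite_measure \<nu>" "sets \<nu> = sets (restrict_space borel (cbox a b))"
begin

lemma space_nu: "space \<nu> = cbox a b"
  using sets_eq_imp_space_eq[OF \<nu>(2)] by (simp add: space_restrict_space)

lemma measurable_nu: "f \<in> borel_measurable borel \<Longrightarrow> f \<in> borel_measurable \<nu>"
  using measurable_restrict_space1[of f borel borel "cbox a b"] measurable_cong_sets[OF \<nu>(2) refl] by blast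

lemma integral_R_hat_measurable:
  assumes \<beta>: "\<beta> \<in> borel_measurable M"
  shows "(\<lambda>\<omega>. \<integral>x. (RH n \<omega> (\<beta> \<omega>) x)\<^sup>2 \<partial>\<nu>) \<in> borel_measurable M"
proof -
  interpret N: finite_measure \<nu> by (rule \<nu>)
  have "(\<lambda>x. x) \<in> borel_measurable \<nu>" by (rule measurable_nu) simp
  then have "(\<lambda>q. (fst q, snd q)) \<in> measurable (M \<Otimes>\<^sub>M \<nu>) (M \<Otimes>\<^sub>M borel)"
    by (intro measurable_Pair measurable_fst measurable_compose[OF measurable_snd])
  from measurable_compose[OF this R_hat_measurable_pair[OF \<beta>, of n]]
  have "(\<lambda>q. (RH n (fst q) (\<beta> (fst q)) (snd q))\<^sup>2) \<in> borel_measurable (M \<Otimes>\<^sub>M \<nu>)" by simp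
  then show ?thesis by (intro N.borel_measurable_lebesgue_integral) (simp add: case_prod_beta)
qed

text \<open>Factor the difference of squares: one factor is at most \<open>e\<close>, the other at
  most \<open>e + 2 * D\<close>, since \<open>f\<close> stays within \<open>e\<close> of
  \<open>\<Delta>\<close>.\<close>

lemma integral_square_diff_le:
  assumes f: "f \<in> borel_measurable borel" and le: "\<And>x. x \<in> cbox a b \<Longrightarrow> \<bar>f x - \<Delta> x\<bar> \<le> e"
    and D: "\<And>x. \<bar>\<Delta> x\<bar> \<le> D"
  shows "\<bar>(\<integral>x. (f x)\<^sup>2 \<partial>\<nu>) - (\<integral>x. (\<Delta> x)\<^sup>2 \<partial>\<nu>)\<bar> \<le> e * (e + 2 * D) * measure \<nu> (cbox a b)"
proof -
  interpret N: finite_measure \<nu> by (rule \<nu>)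
  note [measurable] = measurable_nu[OF f] measurable_nu[OF Delta_measurable]
  have e: "e \<ge> 0" using box_nonempty le order_trans[OF abs_ge_zero] by blast
  have fb: "\<bar>f x\<bar> \<le> e + D" if "x \<in> cbox a b" for x using le[OF that] D[of x] by linarith
  have if2: "integrable \<nu> (\<lambda>x. (f x)\<^sup>2)"
    using power_mono[OF fb abs_ge_zero, of _ 2]
    by (intro N.integrable_const_bound[where B = "(e + D)\<^sup>2"]) (auto simp: space_nu)
  have iD2: "integrable \<nu> (\<lambda>x. (\<Delta> x)\<^sup>2)"
    using power_mono[OF D abs_ge_zero, of _ 2]
    by (intro N.integrable_const_bound[where B = "D\<^sup>2"]) (auto simp: space_nu)
  have pt: "\<bar>(f x)\<^sup>2 - (\<Delta> x)\<^sup>2\<bar> \<le> e * (e + 2 * D)" if "x \<in> cbox a b" for x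
  proof -
    have "\<bar>(f x)\<^sup>2 - (\<Delta> x)\<^sup>2\<bar> = \<bar>f x - \<Delta> x\<bar> * \<bar>f x + \<Delta> x\<bar>"
      by (simp add: abs_mult[symmetric] power2_eq_square algebra_simps)
    also have "\<dots> \<le> e * (e + 2 * D)"
      using le[OF that] fb[OF that] D[of x] e by (intro mult_mono) linarith+
    finally show ?thesis .
  qed
  have "\<bar>(\<integral>x. (f x)\<^sup>2 \<partial>\<nu>) - (\<integral>x. (\<Delta> x)\<^sup>2 \<partial>\<nu>)\<bar> = \<bar>\<integral>x. (f x)\<^sup>2 - (\<Delta> x)\<^sup>2 \<partial>\<nu>\<bar>"
    using if2 iD2 by simp
  also have "\<dots> \<le> (\<integral>x. \<bar>(f x)\<^sup>2 - (\<Delta> x)\<^sup>2\<bar> \<partial>\<nu>)" by (rule integral_abs_bound)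
  also have "\<dots> \<le> (\<integral>x. e * (e + 2 * D) \<partial>\<nu>)"
    using if2 iD2 pt by (intro integral_mono) (auto simp: space_nu)
  finally show ?thesis by (simp add: space_nu mult_ac)
qed

end

end

theorem theorem3:
  fixes M :: "'w measure" and S :: "'u measure" and T :: "'v measure"
    and U :: "nat \<Rightarrow> 'w \<Rightarrow> 'u" and V :: "nat \<Rightarrow> nat \<Rightarrow> 'w \<Rightarrow> 'v"
    and \<tau> :: "'u \<Rightarrow> 'u \<Rightarrow> 'v \<Rightarrow> real \<times> (real ^ 'd)"
    and Y :: "nat \<Rightarrow> nat \<Rightarrow> 'w \<Rightarrow> real" and X :: "nat \<Rightarrow> nat \<Rightarrow> 'w \<Rightarrow> real ^ 'd"
    and a b :: "real ^ 'd" and \<delta> C c :: real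
    and \<beta> :: "nat \<Rightarrow> 'w \<Rightarrow> real ^ 'd" and \<nu> :: "(real ^ 'd) measure"
  assumes sampling: "dyadic_sampling M S T U V \<tau> Y X (cbox a b)"
    and X_bounded: "AE \<omega> in M. norm (X 1 2 \<omega>) \<le> C"
    and Y_moment: "0 < \<delta>" "integrable M (\<lambda>\<omega>. \<bar>Y 1 2 \<omega>\<bar> powr (4 + \<delta>))"
    and Q_nondegenerate: "0 < c" "c \<le> smallest_eigenvalue (pop_Q M (X 1 2))"
    and ols_measurable: "\<And>n. \<beta> n \<in> borel_measurable M"
    and ols: "\<And>n \<omega>. \<omega> \<in> space M \<Longrightarrow> is_ols n (\<lambda>i j. Y i j \<omega>) (\<lambda>i j. X i j \<omega>) (\<beta> n \<omega>)"
    and not_H0: "\<not> linear_cond_mean M (Y 1 2) (X 1 2)"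
    and nu: "finite_measure \<nu>" "sets \<nu> = sets (restrict_space borel (cbox a b))"
  shows "(SUP x\<in>cbox a b. \<bar>Delta M (Y 1 2) (X 1 2) x\<bar>) > 0 \<and>
         tendsto_in_prob M
           (\<lambda>n \<omega>. SUP x\<in>cbox a b. \<bar>R_hat n (\<lambda>i j. Y i j \<omega>) (\<lambda>i j. X i j \<omega>) (\<beta> n \<omega>) x\<bar>)
           (SUP x\<in>cbox a b. \<bar>Delta M (Y 1 2) (X 1 2) x\<bar>) \<and>
         ((\<integral>x. (Delta M (Y 1 2) (X 1 2) x)\<^sup>2 \<partial>\<nu>) > 0 \<longrightarrow>
          tendsto_in_prob M
            (\<lambda>n \<omega>. \<integral>x. (R_hat n (\<lambda>i j. Y i j \<omega>) (\<lambda>i j. X i j \<omega>) (\<beta> n \<omega>) x)\<^sup>2 \<partial>\<nu>)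
            (\<integral>x. (Delta M (Y 1 2) (X 1 2) x)\<^sup>2 \<partial>\<nu>))"
proof -
  interpret dyadic_regression M S T U V \<tau> Y X a b
  proof (intro dyadic_regression.intro dyadic_regression_axioms.intro sampling)
    interpret dyadic_sampling M S T U V \<tau> Y X "cbox a b" by (rule sampling)
    show "integrable M (\<lambda>\<omega>. (Y 1 2 \<omega>)\<^sup>2)"
      using Y_moment(1) by (intro square_integrable_if_powr[OF Y12_measurable _ Y_moment(2)]) simp
    show "0 < smallest_eigenvalue (pop_Q M (X 1 2))" using Q_nondegenerate by simp
  qed
  note close = R_hat_uniformly_consistent[OF ols, unfolded \<Delta>_def]
  have sup: "tendsto_in_prob M
      (\<lambda>n \<omega>. SUP x\<in>cbox a b. \<bar>R_hat n (\<lambda>i j. Y i j \<omega>) (\<lambda>i j. X i j \<omega>) (\<beta> n \<omega>) x\<bar>)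
      (SUP x\<in>cbox a b. \<bar>Delta M (Y 1 2) (X 1 2) x\<bar>)"
  proof (rule tendsto_in_prob_if_whp[OF SUP_R_hat_measurable[OF ols_measurable]])
    fix e :: real assume "e > 0"
    from close[OF _ this] show "whp (\<lambda>n \<omega>. \<bar>(SUP x\<in>cbox a b. \<bar>RH n \<omega> (\<beta> n \<omega>) x\<bar>) -
        (SUP x\<in>cbox a b. \<bar>Delta M (Y 1 2) (X 1 2) x\<bar>)\<bar> \<le> e)"
    proof (rule whp_mono)
      fix n \<omega> assume *: "\<forall>x\<in>cbox a b. \<bar>RH n \<omega> (\<beta> n \<omega>) x - Delta M (Y 1 2) (X 1 2) x\<bar> \<le> e"
      show "\<bar>(SUP x\<in>cbox a b. \<bar>RH n \<omega> (\<beta> n \<omega>) x\<bar>) -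
          (SUP x\<in>cbox a b. \<bar>Delta M (Y 1 2) (X 1 2) x\<bar>)\<bar> \<le> e"
      proof (rule abs_SUP_diff_le[OF box_nonempty bdd_above_Delta[unfolded \<Delta>_def]])
        fix x assume "x \<in> cbox a b"
        then show "\<bar>\<bar>RH n \<omega> (\<beta> n \<omega>) x\<bar> - \<bar>Delta M (Y 1 2) (X 1 2) x\<bar>\<bar> \<le> e"
          by (rule order_trans[OF abs_triangle_ineq3 bspec[OF *]])
      qed
    qed
  qed
  have int: "tendsto_in_prob M
      (\<lambda>n \<omega>. \<integral>x. (R_hat n (\<lambda>i j. Y i j \<omega>) (\<lambda>i j. X i j \<omega>) (\<beta> n \<omega>) x)\<^sup>2 \<partial>\<nu>)
      (\<integral>x. (Delta M (Y 1 2) (X 1 2) x)\<^sup>2 \<partial>\<nu>)"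
  proof (rule tendsto_in_prob_if_whp[OF integral_R_hat_measurable[OF nu ols_measurable]])
    fix e :: real assume e: "e > 0"
    define D where "D = expectation (\<lambda>\<omega>. \<bar>resid (Z12 \<omega>)\<bar>)"
    define m where "m = measure \<nu> (cbox a b)"
    have Dm: "D \<ge> 0" "m \<ge> 0" by (simp_all add: D_def m_def)
    \<comment> \<open>With \<open>e' \<le> 1\<close> the factor \<open>e' + 2 * D\<close> is at most
      \<open>1 + 2 * D\<close>; \<open>m + 1\<close> instead of \<open>m\<close> keeps
      \<open>W\<close> positive when \<open>\<nu>\<close> is the zero measure.\<close>
    define W where "W = (1 + 2 * D) * (m + 1)"
    define e' where "e' = min 1 (e / W)"
    have W: "W > 0" unfolding W_def using Dm by (intro mult_pos_pos) auto
    have "e' \<le> e / W" by (simp add: e'_def)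
    then have "e' * W \<le> e" using W by (simp add: pos_le_divide_eq)
    then have e': "0 < e'" "e' \<le> 1" "e' * ((1 + 2 * D) * (m + 1)) \<le> e"
      using e W by (simp_all add: e'_def W_def)
    have "e' * (e' + 2 * D) * m \<le> e' * (1 + 2 * D) * (m + 1)"
      using e'(1,2) Dm by (intro mult_mono mult_left_mono) auto
    then have le: "e' * (e' + 2 * D) * m \<le> e" using e'(3) by (simp add: mult.assoc)
    from close[OF _ e'(1)] show "whp (\<lambda>n \<omega>. \<bar>(\<integral>x. (RH n \<omega> (\<beta> n \<omega>) x)\<^sup>2 \<partial>\<nu>) -
        (\<integral>x. (Delta M (Y 1 2) (X 1 2) x)\<^sup>2 \<partial>\<nu>)\<bar> \<le> e)"
    proof (rule whp_mono)
      fix n \<omega> assume \<omega>: "\<omega> \<in> space M"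
        and *: "\<forall>x\<in>cbox a b. \<bar>RH n \<omega> (\<beta> n \<omega>) x - Delta M (Y 1 2) (X 1 2) x\<bar> \<le> e'"
      have "\<bar>(\<integral>x. (RH n \<omega> (\<beta> n \<omega>) x)\<^sup>2 \<partial>\<nu>) - (\<integral>x. (\<Delta> x)\<^sup>2 \<partial>\<nu>)\<bar> \<le> e' * (e' + 2 * D) * m"
        unfolding m_def
        by (rule integral_square_diff_le[OF nu R_hat_measurable(2)[OF ols_measurable \<omega>]])
          (use * Delta_bounded in \<open>auto simp: \<Delta>_def D_def\<close>)
      then show "\<bar>(\<integral>x. (RH n \<omega> (\<beta> n \<omega>) x)\<^sup>2 \<partial>\<nu>) -
          (\<integral>x. (Delta M (Y 1 2) (X 1 2) x)\<^sup>2 \<partial>\<nu>)\<bar> \<le> e"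
        using le unfolding \<Delta>_def by (rule order_trans)
    qed
  qed
  from SUP_Delta_pos[OF not_H0] sup int show ?thesis unfolding \<Delta>_def by blast
qed

end
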